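(* Let $H$ be a real finite-dimensional Hilbert space, let $f:H\to\mathbb{R}$ be continuously differentiable and convex, and let $g:H\to\mathbb{R}$ be proper, lower semicontinuous and convex. Let $\mu>0$, $L>0$, $\lambda>0$, and assume that $f$ is strongly convex with constant $\mu$ (so that $\nabla f$ is strongly monotone with modulus $\mu$), that $\nabla f$ is $L$-Lipschitz continuous, and that $\lambda L^2<2\mu$. Let $c_1,c_2>0$, $\kappa_1\in(0,1)$, $\kappa_2>1$, and let $x^*$ be a solution of $$\min_{x\in H} f(x)+g(x).$$ Put $U=\mathrm{prox}_{\lambda g}\circ(\mathrm{Id}-\lambda\nabla f)$. Then $x^*$ is the fixed-time stable equilibrium point of the dynamical system $$\dot x(t)=-\varphi(x)\bigl(x-\mathrm{prox}_{\lambda g}(x-\lambda\nabla f(x))\bigr),\qquad \varphi(x)=\begin{cases}\dfrac{c_1}{\|x-U(x)\|^{1-\kappa_1}}+\dfrac{c_2}{\|x-U(x)\|^{1-\kappa_2}}&\text{if }x\in H\setminus\mathrm{Fix}(U),\\0&\text{otherwise,}\end{cases}$$ with settling time satisfying, for all initial points $x(0)$, $$T(x(0))\le T_{\max}=\frac{1}{p_1(1-\alpha_1)}+\frac{1}{p_2(\alpha_2-1)},$$ where $p_1>0$, $p_2>0$, $\alpha_1\in(0.5,1)$ and $\alpha_2>1$ are some constants (independent of $x(0)$). In addition, if one takes $\alpha_1=1-\frac1{2\xi}$ and $\alpha_2=1+\frac1{2\xi}$ for some $\xi>1$, then the following time estimate holds: $$T(x(0))\le T_{\max}=\frac{\pi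\xi}{\sqrt{p_1p_2}}.$$
   Context: The proximity operator is $\mathrm{prox}_{\lambda g}(x)=\operatorname{argmin}_{y\in H}\{g(y)+\frac1{2\lambda}\|x-y\|^2\}$. $\mathrm{Fix}(U)$ is the set of fixed points of $U$. Stability notions for an autonomous system $\dot x(t)=G(x(t))$, $t\ge0$, with $G:H\to H$ continuous: $x^*$ is an equilibrium point if $G(x^* )=0$. It is (Lyapunov) stable if for every $\epsilon>0$ there is $r>0$ such that for every $x_0$ in the open ball of radius $r$ about $x^*$ the solution with $x(0)=x_0$ exists and stays in the open ball of radius $\epsilon$ about $x^*$ for all $t>0$. It is finite-time stable if it is stable and there are a neighborhood $N$ of $x^*$ and a settling-time function $T:N\setminus\{x^*\}\to(0,\infty)$ such that for every $x(0)\in N\setminus\{x^*\}$ the solution satisfies $x(t)\in N\setminus\{x^*\}$ for all $t\in[0,T(x(0)))$ and $\lim_{t\to T(x(0))}x(t)=x^*$. It is globally finite-time stable if this holds with $N=H$. It is fixed-time stable if it is globally finite-time stable and $\sup_{x(0)\in H} T(x(0))<\infty$. In the paper, the exponents in the time estimate arise as $\alpha_i=\frac{1+\kappa_i}{2}$ for $i=1,2$. *)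

theory Defs
  imports "HOL-Analysis.Analysis"
begin

section \<open>Convex analysis\<close>

text \<open>
  Both notions below are stated for extended-real-valued functions, as is customary; for
  \<open>\<lambda>x. ereal (g x)\<close> with real-valued \<open>g\<close>, properness holds automatically.
\<close>
definition proper :: "('a \<Rightarrow> ereal) \<Rightarrow> bool" where
  "proper h \<longleftrightarrow> (\<forall>x. h x \<noteq> - \<infinity>) \<and> (\<exists>x. h x \<noteq> \<infinity>)"

definition lower_semicontinuous :: "('a::topological_space \<Rightarrow> ereal) \<Rightarrow> bool" where
  "lower_semicontinuous h \<longleftrightarrow> (\<forall>x. h x \<le> Liminf (at x) h)"

definition strongly_convex_on :: "'a::real_normed_vector set \<Rightarrow> real \<Rightarrow> ('a \<Rightarrow> real) \<Rightarrow> bool" where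
  "strongly_convex_on S \<mu> f \<longleftrightarrow> convex S \<and>
     (\<forall>x\<in>S. \<forall>y\<in>S. \<forall>t\<in>{0..1}.
        f ((1 - t) *\<^sub>R x + t *\<^sub>R y)
          \<le> (1 - t) * f x + t * f y - \<mu> / 2 * t * (1 - t) * (norm (x - y))\<^sup>2)"

text \<open>
  The value of \<open>prox\<close> is a minimiser whenever one exists; for \<open>l > 0\<close> and convex, lower
  semicontinuous \<open>g\<close> on a finite-dimensional space the minimiser exists and is unique.
\<close>
definition prox :: "real \<Rightarrow> ('a::real_inner \<Rightarrow> real) \<Rightarrow> 'a \<Rightarrow> 'a" where
  "prox l g x = (ARG_MIN (\<lambda>y. g y + 1 / (2 * l) * (norm (x - y))\<^sup>2) y. True)"

definition Fix :: "('a \<Rightarrow> 'a) \<Rightarrow> 'a set" where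
  "Fix U = {x. U x = x}"

definition scaling ::
  "real \<Rightarrow> real \<Rightarrow> real \<Rightarrow> real \<Rightarrow> ('a::real_normed_vector \<Rightarrow> 'a) \<Rightarrow> 'a \<Rightarrow> real" where
  "scaling c\<^sub>1 c\<^sub>2 \<kappa>\<^sub>1 \<kappa>\<^sub>2 U x =
     (if x \<notin> Fix U
      then c\<^sub>1 / norm (x - U x) powr (1 - \<kappa>\<^sub>1) + c\<^sub>2 / norm (x - U x) powr (1 - \<kappa>\<^sub>2)
      else 0)"

section \<open>Stability of the autonomous system \<open>x' = G x\<close> on \<open>t \<ge> 0\<close>\<close>

text \<open>
  Trajectories are functions on all of \<open>real\<close> of which only the restriction to \<open>t \<ge> 0\<close> is
  meaningful; at \<open>t = 0\<close> the derivative is the one-sided one.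
\<close>
definition solution :: "('a::real_normed_vector \<Rightarrow> 'a) \<Rightarrow> 'a \<Rightarrow> (real \<Rightarrow> 'a) \<Rightarrow> bool" where
  "solution G x0 x \<longleftrightarrow>
     x 0 = x0 \<and> (\<forall>t\<ge>0. (x has_vector_derivative G (x t)) (at t within {0..}))"

definition equilibrium_point :: "('a::real_normed_vector \<Rightarrow> 'a) \<Rightarrow> 'a \<Rightarrow> bool" where
  "equilibrium_point G xs \<longleftrightarrow> G xs = 0"

text \<open>
  For merely continuous \<open>G\<close> uniqueness of solutions is not automatic, so ``the solution from \<open>x0\<close>
  exists and has property \<open>P\<close>'' is rendered as: a solution from \<open>x0\<close> exists and every solution
  from \<open>x0\<close> has property \<open>P\<close>.
\<close>
definition lyapunov_stable :: "('a::real_normed_vector \<Rightarrow> 'a) \<Rightarrow> 'a \<Rightarrow> bool" where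
  "lyapunov_stable G xs \<longleftrightarrow>
     (\<forall>\<epsilon>>0. \<exists>r>0. \<forall>x0 \<in> ball xs r.
        (\<exists>x. solution G x0 x) \<and>
        (\<forall>x. solution G x0 x \<longrightarrow> (\<forall>t>0. x t \<in> ball xs \<epsilon>)))"

text \<open>\<open>T\<close> is only constrained on \<open>N - {xs}\<close>; its value at \<open>xs\<close> is irrelevant.\<close>
definition settling_time ::
  "('a::real_normed_vector \<Rightarrow> 'a) \<Rightarrow> 'a \<Rightarrow> 'a set \<Rightarrow> ('a \<Rightarrow> real) \<Rightarrow> bool" where
  "settling_time G xs N T \<longleftrightarrow>
     (\<forall>x0 \<in> N - {xs}. 0 < T x0 \<and>
        (\<exists>x. solution G x0 x) \<and>
        (\<forall>x. solution G x0 x \<longrightarrow>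
           (\<forall>t\<in>{0..<T x0}. x t \<in> N - {xs}) \<and> (x \<longlongrightarrow> xs) (at (T x0))))"

definition finite_time_stable_on ::
  "('a::real_normed_vector \<Rightarrow> 'a) \<Rightarrow> 'a \<Rightarrow> 'a set \<Rightarrow> bool" where
  "finite_time_stable_on G xs N \<longleftrightarrow>
     lyapunov_stable G xs \<and> xs \<in> interior N \<and> (\<exists>T. settling_time G xs N T)"

definition globally_finite_time_stable :: "('a::real_normed_vector \<Rightarrow> 'a) \<Rightarrow> 'a \<Rightarrow> bool" where
  "globally_finite_time_stable G xs \<longleftrightarrow> finite_time_stable_on G xs UNIV"

text \<open>
  A settling-time function is uniquely determined on \<open>UNIV - {xs}\<close> (it is the first time at which
  the trajectory reaches \<open>xs\<close>), so the quantifier over \<open>T\<close> below ranges over a single function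
  up to its irrelevant value at \<open>xs\<close>.
\<close>
definition fixed_time_stable :: "('a::real_normed_vector \<Rightarrow> 'a) \<Rightarrow> 'a \<Rightarrow> bool" where
  "fixed_time_stable G xs \<longleftrightarrow>
     globally_finite_time_stable G xs \<and>
     (\<forall>T. settling_time G xs UNIV T \<longrightarrow> bdd_above (T ` (UNIV - {xs})))"

end

theory Submission
  imports Defs
begin

text \<open>
  The map \<open>U\<close> is a contraction with unique fixed point \<open>xs\<close>: the prox operator is nonexpansive and
  the gradient step is contracting because \<open>l * L\<^sup>2 < 2 * \<mu>\<close>. Along any solution
  \<open>V = (norm (x - xs))\<^sup>2\<close> satisfies \<open>V' \<le> - (p\<^sub>1 * V powr \<alpha>\<^sub>1 + p\<^sub>2 * V powr \<alpha>\<^sub>2)\<close>, and integrating this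
  inequality gives both bounds on the settling time. The vector field is not Lipschitz at \<open>xs\<close>, so
  solutions are obtained by a change of time: the flow \<open>y' = U y - y\<close> is globally defined and never
  reaches \<open>xs\<close>, and its clock \<open>\<tau>\<close> with \<open>\<tau>' = 1 / \<phi> y\<close> turns it into a solution that reaches \<open>xs\<close>
  at the finite time \<open>T = sup \<tau>\<close>. Conversely any solution, run at the inverse clock, solves the
  Lipschitz equation, so all solutions from one point agree up to \<open>T\<close>.
\<close>

section \<open>Convex analysis of the forward-backward operator\<close>

lemma gderiv_quotient_right:
  assumes "GDERIV F p :> D"
  shows "((\<lambda>t. (F (p + t *\<^sub>R d) - F p) / t) \<longlongrightarrow> d \<bullet> D) (at_right 0)"
proof -
  have F: "(F has_derivative (\<lambda>h. h \<bullet> D)) (at (p + 0 *\<^sub>R d))"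
    using assms by (simp add: gderiv_def)
  have "((\<lambda>t. p + t *\<^sub>R d) has_derivative (\<lambda>t. t *\<^sub>R d)) (at 0)"
    by (auto intro!: derivative_eq_intros)
  then have "((\<lambda>t. F (p + t *\<^sub>R d)) has_derivative (\<lambda>t. (t *\<^sub>R d) \<bullet> D)) (at 0)"
    using F by (rule has_derivative_compose[where f = "\<lambda>t. p + t *\<^sub>R d"])
  then have "((\<lambda>t. F (p + t *\<^sub>R d)) has_real_derivative d \<bullet> D) (at 0)"
    by (simp add: has_field_derivative_def mult.commute[of _ "d \<bullet> D"] mult_commute_abs)
  then have "((\<lambda>t. (F (p + t *\<^sub>R d) - F p) / t) \<longlongrightarrow> d \<bullet> D) (at 0)"
    by (simp add: DERIV_def)
  then show ?thesis
    by (rule filterlim_mono) (simp_all add: at_le)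
qed

text \<open>Compare \<open>p\<close> with \<open>p + t *\<^sub>R (y - p)\<close>: minimality and
  convexity of \<open>g\<close> bound \<open>g p - g y\<close> by the difference quotient of
  \<open>F\<close> for small \<open>t > 0\<close>, and \<open>t\<close> tends to 0. The result says
  that \<open>- D\<close> is a subgradient of \<open>g\<close> at \<open>p\<close>. It is applied
  with the quadratic penalty of \<open>prox\<close> as \<open>F\<close>, and again with
  \<open>f\<close> as \<open>F\<close>.\<close>

lemma convex_composite_minimizer:
  assumes F: "GDERIV F p :> D"
    and g: "convex_on UNIV g"
    and min: "\<And>y. F p + g p \<le> F y + g y"
  shows "g p \<le> g y + (y - p) \<bullet> D"
proof -
  have "g p - g y \<le> (y - p) \<bullet> D"
  proof (rule tendsto_lowerbound[OF gderiv_quotient_right[OF F]])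
    have "g p - g y \<le> (F (p + t *\<^sub>R (y - p)) - F p) / t" if t: "0 < t" "t < 1" for t
    proof -
      have "g (p + t *\<^sub>R (y - p)) \<le> (1 - t) * g p + t * g y"
        using convex_onD[OF g, of t p y] t by (simp add: algebra_simps)
      with min[of "p + t *\<^sub>R (y - p)"] show ?thesis
        using t by (simp add: field_simps)
    qed
    then show "\<forall>\<^sub>F t in at_right 0. g p - g y \<le> (F (p + t *\<^sub>R (y - p)) - F p) / t"
      by (auto simp: eventually_at_right_field intro!: exI[of _ 1])
  qed simp
  then show ?thesis by simp
qed

text \<open>Dividing strong convexity along the segment by \<open>t\<close> and letting
  \<open>t\<close> tend to 0 gives a tangent inequality with gain \<open>\<mu> / 2\<close>. Adding
  it to its copy with \<open>x\<close> and \<open>y\<close> exchanged cancels the function values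
  and doubles the gain.\<close>

lemma strongly_convex_gradient_monotone:
  assumes f: "\<And>x. GDERIV f x :> gradf x"
    and sc: "strongly_convex_on UNIV \<mu> f"
  shows "\<mu> * (norm (x - y))\<^sup>2 \<le> (x - y) \<bullet> (gradf x - gradf y)"
proof -
  have *: "(y - x) \<bullet> gradf x \<le> f y - f x - \<mu> / 2 * (norm (x - y))\<^sup>2" for x y
  proof -
    have lim: "((\<lambda>t. f y - f x - \<mu> / 2 * (1 - t) * (norm (x - y))\<^sup>2) \<longlongrightarrow>
        f y - f x - \<mu> / 2 * (1 - 0) * (norm (x - y))\<^sup>2) (at_right 0)"
      by (intro tendsto_intros)
    have "(f (x + t *\<^sub>R (y - x)) - f x) / t \<le> f y - f x - \<mu> / 2 * (1 - t) * (norm (x - y))\<^sup>2"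
      if t: "0 < t" "t < 1" for t
    proof -
      have "f ((1 - t) *\<^sub>R x + t *\<^sub>R y) \<le>
          (1 - t) * f x + t * f y - \<mu> / 2 * t * (1 - t) * (norm (x - y))\<^sup>2"
        using sc t by (simp add: strongly_convex_on_def)
      also have "(1 - t) *\<^sub>R x + t *\<^sub>R y = x + t *\<^sub>R (y - x)"
        by (simp add: algebra_simps)
      finally show ?thesis
        using t by (simp add: divide_le_eq) (simp add: algebra_simps)
    qed
    then have "\<forall>\<^sub>F t in at_right 0.
        (f (x + t *\<^sub>R (y - x)) - f x) / t \<le> f y - f x - \<mu> / 2 * (1 - t) * (norm (x - y))\<^sup>2"
      by (auto simp: eventually_at_right_field intro!: exI[of _ 1])
    from tendsto_le[OF _ lim gderiv_quotient_right[OF f] this]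
    show ?thesis by simp
  qed
  show ?thesis
    using *[of y x] *[of x y] by (simp add: inner_diff_left inner_diff_right norm_minus_commute)
qed

text \<open>Expand the square: monotonicity controls the cross term, the Lipschitz bound the last
  one. For \<open>l > 0\<close> the resulting factor is below 1 exactly when
  \<open>l * L\<^sup>2 < 2 * \<mu>\<close>.\<close>

lemma gradient_step_contraction:
  fixes x y :: "'a::real_inner"
  assumes mono: "\<mu> * (norm (x - y))\<^sup>2 \<le> (x - y) \<bullet> (u - v)"
    and lip: "norm (u - v) \<le> L * norm (x - y)"
    and l: "l > 0"
  shows "(norm ((x - l *\<^sub>R u) - (y - l *\<^sub>R v)))\<^sup>2 \<le> (1 - 2 * l * \<mu> + l\<^sup>2 * L\<^sup>2) * (norm (x - y))\<^sup>2"
proof -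
  have "(norm (u - v))\<^sup>2 \<le> (L * norm (x - y))\<^sup>2"
    using lip by (intro power_mono) auto
  then have 1: "l\<^sup>2 * (norm (u - v))\<^sup>2 \<le> l\<^sup>2 * L\<^sup>2 * (norm (x - y))\<^sup>2"
    by (simp add: power_mult_distrib mult_left_mono mult.assoc)
  have 2: "l * (\<mu> * (norm (x - y))\<^sup>2) \<le> l * ((x - y) \<bullet> (u - v))"
    using mono l by simp
  have "(x - l *\<^sub>R u) - (y - l *\<^sub>R v) = (x - y) - l *\<^sub>R (u - v)"
    by (simp add: scaleR_diff_right)
  then have "(norm ((x - l *\<^sub>R u) - (y - l *\<^sub>R v)))\<^sup>2 = (norm ((x - y) - l *\<^sub>R (u - v)))\<^sup>2"
    by (rule arg_cong)
  also have "\<dots> = (norm (x - y))\<^sup>2 - 2 * l * ((x - y) \<bullet> (u - v)) + l\<^sup>2 * (norm (u - v))\<^sup>2"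
    by (simp add: power2_eq_square[of l] power2_norm_eq_inner inner_diff_left[of "x - y"]
        inner_diff_right[of _ "x - y"] inner_commute)
  finally show ?thesis
    using 1 2 by (simp add: algebra_simps)
qed

section \<open>The proximity operator\<close>

lemma prox_objective_attains_min:
  fixes g :: "'a::euclidean_space \<Rightarrow> real"
  assumes g: "convex_on UNIV g" and l: "l > 0"
  obtains p where "\<And>y. g p + 1 / (2 * l) * (norm (x - p))\<^sup>2 \<le> g y + 1 / (2 * l) * (norm (x - y))\<^sup>2"
proof -
  have cont: "continuous_on S g" for S
    using convex_on_continuous[OF open_UNIV g] continuous_on_subset by blast
  obtain z where z: "z \<in> cball x 1" "\<And>y. y \<in> cball x 1 \<Longrightarrow> g z \<le> g y"
    using continuous_attains_inf[OF compact_cball _ cont, of x 1] by auto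
  define d where "d = g x - g z"
  \<comment> \<open>By convexity \<open>g\<close> falls at most linearly, with slope
    \<open>d\<close>, at distance at least 1 from \<open>x\<close>. From distance
    \<open>2 * l * d\<close> on, the quadratic term outweighs that fall, so no point outside this
    ball beats \<open>x\<close> itself.\<close>
  define \<rho> where "\<rho> = max 1 (2 * l * d)"
  define h where "h = (\<lambda>y. g y + 1 / (2 * l) * (norm (x - y))\<^sup>2)"
  have "continuous_on (cball x \<rho>) h"
    unfolding h_def by (intro continuous_intros cont)
  moreover have "cball x \<rho> \<noteq> {}"
    by (simp add: \<rho>_def)
  ultimately obtain p where p: "\<And>y. y \<in> cball x \<rho> \<Longrightarrow> h p \<le> h y"
    using continuous_attains_inf[OF compact_cball] by blast
  have "h p \<le> h y" for y
  proof (cases "y \<in> cball x \<rho>")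
    case False
    define r where "r = norm (y - x)"
    have r: "r \<ge> 1" "r \<ge> 2 * l * d"
      using False by (auto simp: \<rho>_def r_def dist_norm norm_minus_commute)
    \<comment> \<open>Pull \<open>y\<close> back along its ray to the unit sphere, where
      \<open>g z\<close> is a lower bound, and solve the convexity inequality for
      \<open>g y\<close>.\<close>
    have "x + (1 / r) *\<^sub>R (y - x) \<in> cball x 1"
      using r by (auto simp: r_def dist_norm)
    then have "g z \<le> g (x + (1 / r) *\<^sub>R (y - x))"
      by (rule z(2))
    also have "\<dots> \<le> (1 - 1 / r) * g x + 1 / r * g y"
      using convex_onD[OF g, of "1 / r" x y] r by (simp add: algebra_simps)
    finally have gy: "g x - r * d \<le> g y"
      using r by (simp add: d_def field_simps)
    have "r * d \<le> r\<^sup>2 / (2 * l)"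
      using mult_left_mono[OF r(2), of r] r(1) l by (simp add: field_simps power2_eq_square)
    with gy have "g x \<le> h y"
      by (simp add: h_def r_def norm_minus_commute)
    moreover have "h p \<le> g x"
      using p[of x] by (simp add: h_def \<rho>_def)
    ultimately show ?thesis by simp
  qed (rule p)
  then show ?thesis
    using that unfolding h_def by blast
qed

lemma prox_minimizes:
  fixes g :: "'a::euclidean_space \<Rightarrow> real"
  assumes g: "convex_on UNIV g" and l: "l > 0"
  shows "g (prox l g x) + 1 / (2 * l) * (norm (x - prox l g x))\<^sup>2
    \<le> g y + 1 / (2 * l) * (norm (x - y))\<^sup>2"
proof -
  obtain p where "\<And>y. g p + 1 / (2 * l) * (norm (x - p))\<^sup>2 \<le> g y + 1 / (2 * l) * (norm (x - y))\<^sup>2"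
    using prox_objective_attains_min[OF g l] by blast
  then have "is_arg_min (\<lambda>y. g y + 1 / (2 * l) * (norm (x - y))\<^sup>2) (\<lambda>_. True) p"
    by (auto simp: is_arg_min_def not_less)
  then have "is_arg_min (\<lambda>y. g y + 1 / (2 * l) * (norm (x - y))\<^sup>2) (\<lambda>_. True) (prox l g x)"
    unfolding prox_def arg_min_def by (rule someI)
  then show ?thesis
    by (auto simp: is_arg_min_def not_less)
qed

text \<open>With \<open>p = prox l g x\<close> this is the inclusion of \<open>(x - p) / l\<close>
  in the subdifferential of \<open>g\<close> at \<open>p\<close>, cleared of the
  denominator.\<close>

lemma prox_variational:
  fixes g :: "'a::euclidean_space \<Rightarrow> real"
  assumes g: "convex_on UNIV g" and l: "l > 0"
  shows "l * g (prox l g x) + (x - prox l g x) \<bullet> (y - prox l g x) \<le> l * g y"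
proof -
  let ?p = "prox l g x"
  have "GDERIV (\<lambda>y. 1 / (2 * l) * (norm (x - y))\<^sup>2) ?p :> (1 / l) *\<^sub>R (?p - x)"
    unfolding gderiv_def power2_norm_eq_inner
    by (rule derivative_eq_intros refl)+
      (use l in \<open>auto simp: fun_eq_iff inner_diff_left inner_diff_right inner_commute field_simps\<close>)
  from convex_composite_minimizer[OF this g, of y] prox_minimizes[OF g l, of x]
  have "g ?p \<le> g y + (y - ?p) \<bullet> ((1 / l) *\<^sub>R (?p - x))"
    by (simp add: add.commute)
  then have "l * g ?p \<le> l * (g y + (y - ?p) \<bullet> ((1 / l) *\<^sub>R (?p - x)))"
    using l by simp
  also have "\<dots> = l * g y - (x - ?p) \<bullet> (y - ?p)"
    using l by (simp add: distrib_left inner_diff_left inner_diff_right inner_commute)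
  finally show ?thesis
    by simp
qed

text \<open>The variational inequality has at most one solution: test the one for \<open>p\<close>
  and the one for \<open>prox l g x\<close> against each other and add. The values of
  \<open>g\<close> cancel and the squared distance is at most 0.\<close>

lemma prox_eqI:
  fixes g :: "'a::euclidean_space \<Rightarrow> real"
  assumes g: "convex_on UNIV g" and l: "l > 0"
    and p: "\<And>y. l * g p + (x - p) \<bullet> (y - p) \<le> l * g y"
  shows "prox l g x = p"
proof -
  let ?p = "prox l g x"
  have "(norm (?p - p))\<^sup>2 = (x - p) \<bullet> (?p - p) + (x - ?p) \<bullet> (p - ?p)"
    by (simp add: power2_norm_eq_inner inner_diff_left inner_diff_right inner_commute)
  also have "\<dots> \<le> 0"
    using p[of ?p] prox_variational[OF g l, of x p] by simp
  finally show ?thesis by simp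
qed

text \<open>The same cross-testing at two base points yields firm nonexpansiveness; Cauchy-Schwarz
  then gives the plain Lipschitz bound.\<close>

lemma prox_nonexpansive:
  fixes g :: "'a::euclidean_space \<Rightarrow> real"
  assumes g: "convex_on UNIV g" and l: "l > 0"
  shows "norm (prox l g x - prox l g y) \<le> norm (x - y)"
proof -
  let ?p = "prox l g x" and ?q = "prox l g y"
  have "(x - ?p) \<bullet> (?q - ?p) + (y - ?q) \<bullet> (?p - ?q) \<le> 0"
    using prox_variational[OF g l, of x ?q] prox_variational[OF g l, of y ?p] by simp
  then have "(norm (?p - ?q))\<^sup>2 \<le> (x - y) \<bullet> (?p - ?q)"
    by (simp add: power2_norm_eq_inner inner_diff_left inner_diff_right inner_commute)
  also have "\<dots> \<le> norm (x - y) * norm (?p - ?q)"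
    by (rule norm_cauchy_schwarz)
  finally show ?thesis
    by (cases "?p = ?q") (simp_all add: power2_eq_square)
qed

section \<open>Contraction and fixed point of the forward-backward step\<close>

lemma forward_backward_contraction:
  fixes f g :: "'a::euclidean_space \<Rightarrow> real"
  assumes f: "\<And>x. GDERIV f x :> gradf x" and sc: "strongly_convex_on UNIV \<mu> f"
    and lip: "L-lipschitz_on UNIV gradf" and g: "convex_on UNIV g"
    and l: "l > 0" and step: "l * L\<^sup>2 < 2 * \<mu>"
  obtains q where "0 \<le> q" "q < 1"
    "\<And>x y. norm (prox l g (x - l *\<^sub>R gradf x) - prox l g (y - l *\<^sub>R gradf y)) \<le> q * norm (x - y)"
proof -
  \<comment> \<open>The maximum with 0 permits the square root without first comparing \<mu> with
    \<open>L\<close>.\<close>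
  define s where "s = max 0 (1 - 2 * l * \<mu> + l\<^sup>2 * L\<^sup>2)"
  have "l * (l * L\<^sup>2) < l * (2 * \<mu>)"
    using step l by simp
  then have s: "0 \<le> s" "s < 1"
    by (auto simp: s_def power2_eq_square)
  have "norm (prox l g (x - l *\<^sub>R gradf x) - prox l g (y - l *\<^sub>R gradf y)) \<le> sqrt s * norm (x - y)"
    for x y
  proof -
    have "norm (gradf x - gradf y) \<le> L * norm (x - y)"
      using lipschitz_onD[OF lip, of x y] by (simp add: dist_norm)
    from gradient_step_contraction[OF strongly_convex_gradient_monotone[OF f sc] this l]
    have "(norm ((x - l *\<^sub>R gradf x) - (y - l *\<^sub>R gradf y)))\<^sup>2
        \<le> (1 - 2 * l * \<mu> + l\<^sup>2 * L\<^sup>2) * (norm (x - y))\<^sup>2" .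
    also have "\<dots> \<le> s * (norm (x - y))\<^sup>2"
      by (intro mult_right_mono) (auto simp: s_def)
    also have "\<dots> = (sqrt s * norm (x - y))\<^sup>2"
      using s by (simp add: power_mult_distrib)
    finally have "norm ((x - l *\<^sub>R gradf x) - (y - l *\<^sub>R gradf y)) \<le> sqrt s * norm (x - y)"
      by (rule power2_le_imp_le) (use s in simp)
    then show ?thesis
      using prox_nonexpansive[OF g l] order_trans by blast
  qed
  then show ?thesis
    using that[of "sqrt s"] s by simp
qed

text \<open>Minimality makes \<open>- D\<close> a subgradient of \<open>g\<close> at
  \<open>xs\<close>. Multiplied by \<open>l\<close>, this is the variational inequality
  characterising \<open>xs\<close> as the prox of \<open>xs - l *\<^sub>R D\<close>.\<close>

lemma forward_backward_fixed_point:
  fixes f g :: "'a::euclidean_space \<Rightarrow> real"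
  assumes f: "GDERIV f xs :> D" and g: "convex_on UNIV g" and l: "l > 0"
    and min: "is_arg_min (\<lambda>x. f x + g x) (\<lambda>_. True) xs"
  shows "prox l g (xs - l *\<^sub>R D) = xs"
proof (rule prox_eqI[OF g l])
  fix y
  have "g xs \<le> g y + (y - xs) \<bullet> D"
    using min by (intro convex_composite_minimizer[OF f g]) (auto simp: is_arg_min_def not_less)
  then have "l * g xs \<le> l * (g y + (y - xs) \<bullet> D)"
    using l by simp
  then show "l * g xs + (xs - l *\<^sub>R D - xs) \<bullet> (y - xs) \<le> l * g y"
    by (simp add: distrib_left inner_commute)
qed

section \<open>Scalar comparison estimates\<close>

text \<open>A function \<Phi> with slope at least \<open>1 / w\<close> decreases along
  \<open>V\<close> at rate at least 1, so it acts as a clock: lower and upper bounds on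
  \<open>\<Phi> (V u)\<close> bound the elapsed time.\<close>

lemma clock_comparison:
  fixes V V' \<Phi> \<Phi>' w :: "real \<Rightarrow> real"
  assumes "s \<le> t" and cont: "continuous_on {s..t} V"
    and pos: "\<And>u. u \<in> {s..t} \<Longrightarrow> V u > 0"
    and V: "\<And>u. u \<in> {s<..<t} \<Longrightarrow> (V has_real_derivative V' u) (at u)"
    and V': "\<And>u. u \<in> {s<..<t} \<Longrightarrow> V' u \<le> - w (V u)"
    and \<Phi>: "\<And>v. v > 0 \<Longrightarrow> (\<Phi> has_real_derivative \<Phi>' v) (at v)"
    and \<Phi>': "\<And>v. v > 0 \<Longrightarrow> \<Phi>' v \<ge> 0" "\<And>v. v > 0 \<Longrightarrow> 1 \<le> \<Phi>' v * w v"
  shows "\<Phi> (V t) + t \<le> \<Phi> (V s) + s"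
proof (rule DERIV_nonpos_imp_decreasing_open[OF \<open>s \<le> t\<close>, of "\<lambda>u. \<Phi> (V u) + u"])
  fix u assume u: "s < u" "u < t"
  then have Vu: "V u > 0" by (simp add: pos)
  have "((\<lambda>u. \<Phi> (V u) + u) has_real_derivative \<Phi>' (V u) * V' u + 1) (at u)"
    using u by (intro DERIV_add DERIV_ident DERIV_chain2[OF \<Phi>[OF Vu] V]) auto
  moreover have "\<Phi>' (V u) * V' u \<le> \<Phi>' (V u) * - w (V u)"
    using V'[of u] \<Phi>'(1)[OF Vu] u by (intro mult_left_mono) auto
  then have "\<Phi>' (V u) * V' u + 1 \<le> 0"
    using \<Phi>'(2)[OF Vu] by simp
  ultimately show "\<exists>y. ((\<lambda>u. \<Phi> (V u) + u) has_real_derivative y) (at u) \<and> y \<le> 0"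
    by blast
next
  have "continuous_on {0<..} \<Phi>"
    using \<Phi> by (auto intro!: continuous_at_imp_continuous_on DERIV_isCont)
  then have "continuous_on {s..t} (\<lambda>u. \<Phi> (V u))"
    by (rule continuous_on_compose2[OF _ cont]) (use pos in auto)
  then show "continuous_on {s..t} (\<lambda>u. \<Phi> (V u) + u)"
    by (intro continuous_intros)
qed

lemma powr_clock:
  fixes V V' :: "real \<Rightarrow> real"
  assumes "s \<le> t" and "continuous_on {s..t} V"
    and "\<And>u. u \<in> {s..t} \<Longrightarrow> V u > 0"
    and "\<And>u. u \<in> {s<..<t} \<Longrightarrow> (V has_real_derivative V' u) (at u)"
    and "\<And>u. u \<in> {s<..<t} \<Longrightarrow> V' u \<le> - (A * V u powr \<alpha>)"
    and A: "A > 0" and \<alpha>: "\<alpha> \<noteq> 1"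
  shows "V t powr (1 - \<alpha>) / (A * (1 - \<alpha>)) + t \<le> V s powr (1 - \<alpha>) / (A * (1 - \<alpha>)) + s"
proof (rule clock_comparison[where w = "\<lambda>v. A * v powr \<alpha>" and \<Phi>' = "\<lambda>v. v powr - \<alpha> / A"
      and \<Phi> = "\<lambda>v. v powr (1 - \<alpha>) / (A * (1 - \<alpha>))", OF assms(1-5)])
  fix v :: real assume v: "v > 0"
  have "((\<lambda>v. v powr (1 - \<alpha>) / (A * (1 - \<alpha>))) has_real_derivative
      ((1 - \<alpha>) * v powr (1 - \<alpha> - 1)) / (A * (1 - \<alpha>))) (at v)"
    using v by (intro DERIV_cdivide has_real_derivative_powr)
  then show "((\<lambda>v. v powr (1 - \<alpha>) / (A * (1 - \<alpha>))) has_real_derivative v powr - \<alpha> / A) (at v)"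
    using \<alpha> by simp
  show "0 \<le> v powr - \<alpha> / A" "1 \<le> v powr - \<alpha> / A * (A * v powr \<alpha>)"
    using v A by (simp_all add: powr_minus field_simps)
qed auto

lemma fixed_time_bound:
  fixes V V' :: "real \<Rightarrow> real"
  assumes b: "0 \<le> b" and cont: "continuous_on {0..b} V"
    and pos: "\<And>u. u \<in> {0..b} \<Longrightarrow> V u > 0"
    and V: "\<And>u. u \<in> {0<..<b} \<Longrightarrow> (V has_real_derivative V' u) (at u)"
    and V': "\<And>u. u \<in> {0<..<b} \<Longrightarrow> V' u \<le> - (A * V u powr \<alpha> + B * V u powr \<beta>)"
    and A: "A > 0" and B: "B > 0" and \<alpha>: "\<alpha> < 1" and \<beta>: "\<beta> > 1"
  shows "b \<le> 1 / (A * (1 - \<alpha>)) + 1 / (B * (\<beta> - 1))"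
proof -
  \<comment> \<open>At time \<open>t\<close> the superlinear term has brought \<open>V\<close> down to at most 1, however large \<open>V 0\<close> is.\<close>
  define t where "t = 1 / (B * (\<beta> - 1))"
  have t: "t \<ge> 0"
    using B \<beta> by (simp add: t_def)
  have cont': "continuous_on {c..d} V" if "0 \<le> c" "d \<le> b" for c d
    using cont by (rule continuous_on_subset) (use that in auto)
  show ?thesis
  proof (cases "b \<le> t")
    case True
    then show ?thesis
      using A \<alpha> by (simp add: t_def add_increasing)
  next
    case False
    have V'\<beta>: "V' u \<le> - (B * V u powr \<beta>)" and V'\<alpha>: "V' u \<le> - (A * V u powr \<alpha>)"
      if "u \<in> {0<..<b}" for u
    proof -
      have "0 \<le> A * V u powr \<alpha>" "0 \<le> B * V u powr \<beta>"
        using A B by simp_all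
      with V'[OF that] show "V' u \<le> - (B * V u powr \<beta>)" "V' u \<le> - (A * V u powr \<alpha>)"
        by linarith+
    qed
    have "V t powr (1 - \<beta>) / (B * (1 - \<beta>)) + t \<le> V 0 powr (1 - \<beta>) / (B * (1 - \<beta>)) + 0"
      by (rule powr_clock[where V' = V']) (use False t pos V V'\<beta> B \<beta> in \<open>auto intro!: cont'\<close>)
    also have "\<dots> \<le> 0"
      using B \<beta> by (simp add: divide_nonneg_neg mult_pos_neg)
    finally have "t \<le> V t powr (1 - \<beta>) / (B * (\<beta> - 1))"
      using B \<beta> by (simp add: field_simps)
    then have "1 \<le> V t powr (1 - \<beta>)"
      using B \<beta> unfolding t_def by (subst (asm) divide_le_cancel) simp
    then have "V t \<le> 1"
      using powr_less_mono2_neg[of "1 - \<beta>" 1 "V t"] \<beta> by force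
    then have Vt: "V t powr (1 - \<alpha>) \<le> 1"
      using \<alpha> pos[of t] False t by (simp add: powr_le1)
    \<comment> \<open>Second phase: from a value at most 1 the sublinear term alone leaves at most
      \<open>1 / (A * (1 - \<alpha>))\<close> of further time.\<close>
    have "V b powr (1 - \<alpha>) / (A * (1 - \<alpha>)) + b \<le> V t powr (1 - \<alpha>) / (A * (1 - \<alpha>)) + t"
      by (rule powr_clock[where V' = V']) (use False t pos V V'\<alpha> A \<alpha> in \<open>auto intro!: cont'\<close>)
    moreover have "0 \<le> V b powr (1 - \<alpha>) / (A * (1 - \<alpha>))"
      using A \<alpha> by simp
    moreover have "V t powr (1 - \<alpha>) / (A * (1 - \<alpha>)) \<le> 1 / (A * (1 - \<alpha>))"
      using Vt A \<alpha> by (intro divide_right_mono) auto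
    ultimately show ?thesis
      by (simp add: t_def)
  qed
qed

text \<open>For exponents \<open>1 - e\<close> and \<open>1 + e\<close> symmetric about 1, the
  reciprocal of the full right-hand side has an arctangent as primitive, so both terms are used at
  once. On positive arguments the arctangent varies by at most \<open>pi / 2\<close>, and
  \<open>e = 1 / (2 * \<xi>)\<close> turns this into the stated bound.\<close>

lemma fixed_time_bound_pi:
  fixes V V' :: "real \<Rightarrow> real"
  assumes b: "0 \<le> b" and cont: "continuous_on {0..b} V"
    and pos: "\<And>u. u \<in> {0..b} \<Longrightarrow> V u > 0"
    and V: "\<And>u. u \<in> {0<..<b} \<Longrightarrow> (V has_real_derivative V' u) (at u)"
    and V': "\<And>u. u \<in> {0<..<b} \<Longrightarrow>
      V' u \<le> - (A * V u powr (1 - 1 / (2 * \<xi>)) + B * V u powr (1 + 1 / (2 * \<xi>)))"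
    and A: "A > 0" and B: "B > 0" and \<xi>: "\<xi> > 0"
  shows "b \<le> pi * \<xi> / sqrt (A * B)"
proof -
  define e where "e = 1 / (2 * \<xi>)"
  have e: "e > 0"
    using \<xi> by (simp add: e_def)
  define \<Phi> where "\<Phi> = (\<lambda>v. arctan (sqrt (B / A) * v powr e) / (e * sqrt (A * B)))"
  have "\<Phi> (V b) + b \<le> \<Phi> (V 0) + 0"
  proof (rule clock_comparison[where w = "\<lambda>v. A * v powr (1 - e) + B * v powr (1 + e)"
      and \<Phi>' = "\<lambda>v. 1 / (A * v powr (1 - e) + B * v powr (1 + e))",
      OF b cont pos V V'[folded e_def]])
    fix v :: real assume v: "v > 0"
    have "v powr (1 - e) > 0" "v powr (1 + e) > 0"
      using v by simp_all
    then have w: "A * v powr (1 - e) + B * v powr (1 + e) > 0"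
      using A B by (intro add_pos_pos mult_pos_pos)
    then show "0 \<le> 1 / (A * v powr (1 - e) + B * v powr (1 + e))"
      "1 \<le> 1 / (A * v powr (1 - e) + B * v powr (1 + e)) * (A * v powr (1 - e) + B * v powr (1 + e))"
      by simp_all
    have "(\<Phi> has_real_derivative
        (inverse (1 + (sqrt (B / A) * v powr e)\<^sup>2) * (sqrt (B / A) * (e * v powr (e - 1))))
          / (e * sqrt (A * B))) (at v)"
      unfolding \<Phi>_def using v
      by (intro DERIV_cdivide DERIV_chain2[OF DERIV_arctan] DERIV_cmult has_real_derivative_powr)
    also have "(inverse (1 + (sqrt (B / A) * v powr e)\<^sup>2) * (sqrt (B / A) * (e * v powr (e - 1))))
          / (e * sqrt (A * B)) = 1 / (A * v powr (1 - e) + B * v powr (1 + e))"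
    proof -
      have "sqrt (B / A) / sqrt (A * B) = sqrt ((1 / A)\<^sup>2)"
        unfolding real_sqrt_divide[symmetric] using A B by (simp add: power2_eq_square)
      then have r: "sqrt (B / A) / sqrt (A * B) = 1 / A"
        using A by simp
      have s: "(sqrt (B / A) * v powr e)\<^sup>2 = B / A * v powr (2 * e)"
        using A B powr_add[of v e e] by (simp add: power_mult_distrib power2_eq_square[of "v powr e"])
      have "(inverse (1 + (sqrt (B / A) * v powr e)\<^sup>2) * (sqrt (B / A) * (e * v powr (e - 1))))
          / (e * sqrt (A * B)) = inverse (1 + B / A * v powr (2 * e)) * v powr (e - 1)
          * (sqrt (B / A) / sqrt (A * B))"
        using e by (simp add: s)
      also have "\<dots> = v powr (e - 1) / (A + B * v powr (2 * e))"
        using A unfolding r by (simp add: divide_simps)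
      also have "\<dots> = 1 / (v powr (1 - e) * (A + B * v powr (2 * e)))"
        using powr_minus_divide[of v "1 - e"] by simp
      also have "v powr (1 - e) * (A + B * v powr (2 * e)) = A * v powr (1 - e) + B * v powr (1 + e)"
        using powr_add[of v "1 - e" "2 * e"] by (simp add: algebra_simps)
      finally show ?thesis .
    qed
    finally show "(\<Phi> has_real_derivative 1 / (A * v powr (1 - e) + B * v powr (1 + e))) (at v)" .
  qed
  moreover have "0 \<le> \<Phi> (V b)"
    using A B e by (simp add: \<Phi>_def)
  moreover have "\<Phi> (V 0) \<le> (pi / 2) / (e * sqrt (A * B))"
    unfolding \<Phi>_def using A B e arctan_ubound by (intro divide_right_mono) (auto intro: less_imp_le)
  moreover have "(pi / 2) / (e * sqrt (A * B)) = pi * \<xi> / sqrt (A * B)"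
    using \<xi> by (simp add: e_def field_simps)
  ultimately show ?thesis
    by linarith
qed

section \<open>Ordinary differential equations\<close>

lemma halfline_integral_derivative:
  fixes h :: "real \<Rightarrow> 'a::banach"
  assumes h: "continuous_on {0..} h" and t: "t \<ge> 0"
  shows "((\<lambda>u. integral {0..u} h) has_vector_derivative h t) (at t within {0..})"
proof -
  have "((\<lambda>u. integral {0..u} h) has_vector_derivative h t) (at t within {0..t + 1})"
    using t by (intro integral_has_vector_derivative continuous_on_subset[OF h]) auto
  moreover have "at t within {0..t + 1} = at t within {0..}"
    by (rule at_within_nhd[of _ "{..<t + 1}"]) auto
  ultimately show ?thesis by simp
qed

text \<open>A continuous curve satisfying the equation off a finite set satisfies the integral
  equation, and continuity of \<open>G\<close> along it restores the derivative at the exceptional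
  times and, one-sided, at 0. This admits trajectories glued at the hitting time.\<close>

lemma solutionI:
  fixes G :: "'a::banach \<Rightarrow> 'a"
  assumes x: "continuous_on {0..} x" and G: "continuous_on UNIV G" and S: "finite S"
    and der: "\<And>t. t > 0 \<Longrightarrow> t \<notin> S \<Longrightarrow> (x has_vector_derivative G (x t)) (at t)"
  shows "solution G (x 0) x"
  unfolding solution_def
proof (intro conjI allI impI refl)
  fix t :: real assume t: "t \<ge> 0"
  have Gx: "continuous_on {0..} (\<lambda>t. G (x t))"
    by (rule continuous_on_compose2[OF G x]) simp
  have eq: "x u = x 0 + integral {0..u} (\<lambda>t. G (x t))" if "u \<ge> 0" for u
  proof -
    have cont: "continuous_on {0..u} x"
      using x by (rule continuous_on_subset) auto
    have "((\<lambda>t. G (x t)) has_integral (x u - x 0)) {0..u}"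
      by (rule fundamental_theorem_of_calculus_interior_strong[OF S that _ cont], rule der) auto
    from integral_unique[OF this] show ?thesis by simp
  qed
  have "((\<lambda>u. x 0 + integral {0..u} (\<lambda>t. G (x t))) has_vector_derivative 0 + G (x t)) (at t within {0..})"
    by (rule has_vector_derivative_add[OF has_vector_derivative_const
          halfline_integral_derivative[OF Gx t]])
  then have "((\<lambda>u. x 0 + integral {0..u} (\<lambda>t. G (x t))) has_vector_derivative G (x t)) (at t within {0..})"
    by simp
  then show "(x has_vector_derivative G (x t)) (at t within {0..})"
    by (rule has_vector_derivative_transform[rotated 2]) (use t in simp, rule eq, simp)
qed

text \<open>After multiplication by \<open>exp (- m)\<close> the bound becomes
  \<open>M * (1 - exp (- m))\<close>, which is at most \<open>M\<close> uniformly in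
  \<open>m\<close>; this keeps the integral operator bounded and contracting on the half
  line.\<close>

lemma exp_weighted_integral_bound:
  fixes h :: "real \<Rightarrow> 'a::banach"
  assumes m: "m \<ge> 0" and h: "continuous_on {0..m} h" and M: "\<And>t. t \<in> {0..m} \<Longrightarrow> norm (h t) \<le> M"
  shows "norm (integral {0..m} (\<lambda>t. exp t *\<^sub>R h t)) \<le> M * (exp m - 1)"
proof -
  have "(exp has_integral (exp m - exp 0)) {0..m}"
    using m by (intro fundamental_theorem_of_calculus)
      (auto intro!: derivative_eq_intros simp flip: has_real_derivative_iff_has_vector_derivative)
  then have e: "((\<lambda>t. M * exp t) has_integral M * (exp m - 1)) {0..m}"
    by (intro has_integral_mult_right) simp
  have "norm (integral {0..m} (\<lambda>t. exp t *\<^sub>R h t)) \<le> integral {0..m} (\<lambda>t. M * exp t)"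
  proof (rule integral_norm_bound_integral)
    show "(\<lambda>t. exp t *\<^sub>R h t) integrable_on {0..m}"
      by (intro integrable_continuous_real continuous_intros h)
    show "norm (exp t *\<^sub>R h t) \<le> M * exp t" if "t \<in> {0..m}" for t
      using M[OF that] by (simp add: mult.commute)
  qed (use e in blast)
  then show ?thesis
    unfolding integral_unique[OF e] .
qed

text \<open>The map \<open>norm v powr (\<kappa> - 1) *\<^sub>R v\<close> has norm
  \<open>norm v powr \<kappa>\<close>, which tends to 0 at the origin even when
  \<open>\<kappa> < 1\<close> and the scalar factor blows up.\<close>

lemma norm_powr_scaleR_continuous:
  fixes R :: "'a::topological_space \<Rightarrow> 'b::real_normed_vector"
  assumes R: "continuous_on UNIV R" and \<kappa>: "\<kappa> > 0"
  shows "continuous_on UNIV (\<lambda>x. norm (R x) powr (\<kappa> - 1) *\<^sub>R R x)"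
proof -
  have "isCont (\<lambda>v::'b. norm v powr (\<kappa> - 1) *\<^sub>R v) v" for v
  proof (cases "v = 0")
    case True
    have "norm (norm w powr (\<kappa> - 1) *\<^sub>R w) = norm w powr \<kappa>" for w :: 'b
      using powr_mult_base[of "norm w" "\<kappa> - 1"] by (simp add: mult.commute)
    moreover have "((\<lambda>w::'b. norm w powr \<kappa>) \<longlongrightarrow> 0) (at 0)"
      by (rule tendsto_zero_powrI[OF tendsto_norm_zero[OF tendsto_ident_at] tendsto_const]) (use \<kappa> in auto)
    ultimately have "((\<lambda>w::'b. norm (norm w powr (\<kappa> - 1) *\<^sub>R w)) \<longlongrightarrow> 0) (at 0)"
      by presburger
    then have "((\<lambda>w::'b. norm w powr (\<kappa> - 1) *\<^sub>R w) \<longlongrightarrow> 0) (at 0)"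
      by (rule tendsto_norm_zero_cancel)
    with True show ?thesis
      by (simp add: isCont_def)
  next
    case False
    then show ?thesis
      unfolding isCont_def
      by (intro tendsto_scaleR tendsto_powr tendsto_norm tendsto_const tendsto_ident_at) simp
  qed
  then have "continuous_on UNIV (\<lambda>v::'b. norm v powr (\<kappa> - 1) *\<^sub>R v)"
    by (intro continuous_at_imp_continuous_on) blast
  then show ?thesis
    by (rule continuous_on_compose2[OF _ R]) simp
qed

text \<open>
  Written by variation of constants, the integral operator contracts the plain sup norm on the whole
  half line, so a single application of Banach's theorem yields the global solution.
\<close>
lemma contraction_flow_exists:
  fixes U :: "'a::banach \<Rightarrow> 'a"
  assumes q: "0 \<le> q" "q < 1" and U: "\<And>x y. norm (U x - U y) \<le> q * norm (x - y)"
  obtains y where "y 0 = x0" "continuous_on UNIV y"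
    "\<And>s. s > 0 \<Longrightarrow> (y has_vector_derivative U (y s) - y s) (at s)"
proof -
  have "q-lipschitz_on UNIV U"
    using q U by (intro lipschitz_onI) (auto simp: dist_norm)
  then have U_cont: "continuous_on UNIV U"
    by (rule lipschitz_on_continuous_on)
  define I where "I y m = integral {0..m} (\<lambda>t. exp t *\<^sub>R U (y t))" for y :: "real \<Rightarrow>\<^sub>C 'a" and m
  \<comment> \<open>Freezing negative times at 0 makes \<open>P y\<close> constantly
    \<open>x0\<close> there, so the complete space of bounded continuous functions on all of
    \<open>real\<close> can be used.\<close>
  define P where "P y s = exp (- max 0 s) *\<^sub>R (x0 + I y (max 0 s))" for y s
  have Uy: "continuous_on S (\<lambda>t. U (apply_bcontfun y t))" for S and y :: "real \<Rightarrow>\<^sub>C 'a"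
    by (rule continuous_on_compose2[OF U_cont]) auto
  have I_der: "(I y has_vector_derivative exp s *\<^sub>R U (y s)) (at s within {0..})" if "s \<ge> 0" for y and s
    unfolding I_def
    by (rule halfline_integral_derivative[OF _ that, where h = "\<lambda>t. exp t *\<^sub>R U (apply_bcontfun y t)"])
      (intro continuous_intros Uy)
  have P_bcontfun: "P y \<in> bcontfun" for y
  proof -
    have "continuous_on {0..} (I y)"
      using I_der has_vector_derivative_continuous
      by (fastforce simp: continuous_on_eq_continuous_within)
    then have "continuous_on UNIV (\<lambda>s. I y (max 0 s))"
      by (rule continuous_on_compose2) (auto intro!: continuous_intros)
    then have "continuous_on UNIV (P y)"
      unfolding P_def by (intro continuous_intros)
    moreover have "bounded (range (P y))"
    proof -
      obtain M where M: "norm (apply_bcontfun y t) \<le> M" for t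
        using bounded_apply_bcontfun[of y] by (auto simp: bounded_iff)
      have UM: "norm (U (y t)) \<le> norm (U 0) + M" for t
      proof -
        have "norm (U (y t)) \<le> norm (U 0) + norm (U (y t) - U 0)"
          by (rule norm_triangle_sub)
        also have "norm (U (y t) - U 0) \<le> 1 * M"
          using U[of "y t" 0] M[of t] q
            mult_mono[of q 1 "norm (y t)" M] by simp
        finally show ?thesis by simp
      qed
      have M0: "0 \<le> norm (U 0) + M"
        using UM[of 0] norm_ge_zero order_trans by blast
      have "norm (P y s) \<le> norm x0 + (norm (U 0) + M)" for s
      proof -
        let ?m = "max 0 s"
        have "norm (P y s) \<le> exp (- ?m) * (norm x0 + norm (I y ?m))"
          unfolding P_def by (simp add: norm_triangle_ineq)
        also have "\<dots> \<le> exp (- ?m) * (norm x0 + (norm (U 0) + M) * (exp ?m - 1))"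
          unfolding I_def
          by (intro mult_left_mono add_left_mono exp_weighted_integral_bound UM Uy) auto
        also have "\<dots> = exp (- ?m) * norm x0 + (norm (U 0) + M) * (1 - exp (- ?m))"
          by (simp add: algebra_simps flip: exp_add)
        also have "\<dots> \<le> 1 * norm x0 + (norm (U 0) + M) * 1"
          by (intro add_mono mult_right_mono mult_left_mono M0) auto
        finally show ?thesis by simp
      qed
      then show ?thesis
        by (auto simp: bounded_iff)
    qed
    ultimately show ?thesis
      by (simp add: bcontfun_def)
  qed
  define F where "F y = Bcontfun (P y)" for y
  have F: "apply_bcontfun (F y) = P y" for y
    unfolding F_def by (rule Bcontfun_inverse[OF P_bcontfun])
  have "dist (F y) (F z) \<le> q * dist y z" for y z
  proof (rule dist_bound)
    fix s :: real
    let ?m = "max 0 s"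
    have int: "(\<lambda>t. exp t *\<^sub>R U (apply_bcontfun y t)) integrable_on {0..?m}" for y :: "real \<Rightarrow>\<^sub>C 'a"
      by (intro integrable_continuous_real continuous_intros Uy)
    have "I y ?m - I z ?m = integral {0..?m} (\<lambda>t. exp t *\<^sub>R (U (y t) - U (z t)))"
      unfolding I_def by (subst integral_diff[symmetric, OF int int]) (simp add: scaleR_diff_right)
    also have "norm \<dots> \<le> q * dist y z * (exp ?m - 1)"
    proof (intro exp_weighted_integral_bound continuous_intros Uy)
      show "norm (U (y t) - U (z t)) \<le> q * dist y z" for t
        using U[of "y t" "z t"] dist_bounded[of y t z] q mult_left_mono[of "dist (y t) (z t)" "dist y z" q]
        by (simp add: dist_norm)
    qed simp
    finally have le: "norm (I y ?m - I z ?m) \<le> q * dist y z * (exp ?m - 1)" .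
    have "dist (F y s) (F z s) = exp (- ?m) * norm (I y ?m - I z ?m)"
      by (simp add: F P_def dist_norm flip: scaleR_diff_right)
    also have "\<dots> \<le> exp (- ?m) * (q * dist y z * (exp ?m - 1))"
      using le by simp
    also have "\<dots> = q * dist y z * (1 - exp (- ?m))"
      by (simp add: algebra_simps flip: exp_add)
    also have "\<dots> \<le> q * dist y z * 1"
      using q by (intro mult_left_mono) auto
    finally show "dist (F y s) (F z s) \<le> q * dist y z" by simp
  qed
  then obtain y where y: "F y = y"
    using banach_fix_type[OF q, of F] by blast
  then have yP: "apply_bcontfun y s = P y s" for s
    using F[of y] by simp
  show ?thesis
  proof (rule that)
    show "y 0 = x0"
      unfolding yP by (simp add: P_def I_def)
    show "continuous_on UNIV (apply_bcontfun y)" by simp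
    fix s :: real assume s: "s > 0"
    have "at s within {0..} = at s"
      using s by (intro at_within_interior) simp
    with I_der[of s y] s have I: "(I y has_vector_derivative exp s *\<^sub>R U (y s)) (at s)"
      by simp
    have E: "((\<lambda>s. exp (- s)) has_real_derivative - exp (- s)) (at s)"
      by (auto intro!: derivative_eq_intros)
    have "((\<lambda>s. exp (- s) *\<^sub>R (x0 + I y s)) has_vector_derivative
        exp (- s) *\<^sub>R (0 + exp s *\<^sub>R U (y s)) + - exp (- s) *\<^sub>R (x0 + I y s)) (at s)"
      by (rule has_vector_derivative_scaleR[OF E
            has_vector_derivative_add[OF has_vector_derivative_const I]])
    moreover have "exp (- s) *\<^sub>R (0 + exp s *\<^sub>R U (y s)) + - exp (- s) *\<^sub>R (x0 + I y s)
        = U (y s) - y s"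
      using yP[of s] s by (simp add: P_def exp_minus)
    ultimately have "((\<lambda>s. exp (- s) *\<^sub>R (x0 + I y s)) has_vector_derivative U (y s) - y s) (at s)"
      by simp
    then show "(y has_vector_derivative U (y s) - y s) (at s)"
    proof (rule has_vector_derivative_transform_within_open[of _ _ _ "{0<..}"])
      show "exp (- r) *\<^sub>R (x0 + I y r) = apply_bcontfun y r" if "r \<in> {0<..}" for r
        using yP[of r] that by (simp add: P_def)
    qed (use s in auto)
  qed
qed

section \<open>The rescaled dynamics of a contraction\<close>

lemma has_real_derivative_norm_sq:
  fixes f :: "real \<Rightarrow> 'a::real_inner"
  assumes "(f has_vector_derivative f') (at t)"
  shows "((\<lambda>t. (norm (f t))\<^sup>2) has_real_derivative 2 * (f t \<bullet> f')) (at t)"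
  using bounded_bilinear.has_vector_derivative[OF bounded_bilinear_inner assms assms]
  by (simp add: power2_norm_eq_inner has_real_derivative_iff_has_vector_derivative inner_commute)

lemma solution_continuous_on: "solution G x0 z \<Longrightarrow> continuous_on {0..} z"
  unfolding solution_def continuous_on_eq_continuous_within
  by (auto intro: has_vector_derivative_continuous)

lemma solution_derivative_at:
  assumes "solution G x0 z" "t > 0"
  shows "(z has_vector_derivative G (z t)) (at t)"
proof -
  have "at t within {0..} = at t"
    using assms by (intro at_within_interior) simp
  then show ?thesis
    using assms unfolding solution_def by (metis less_imp_le)
qed

text \<open>From here on \<open>f\<close> and \<open>g\<close> enter only through the contraction
  factor and the fixed point of \<open>U\<close>.\<close>

locale contraction_dynamics =
  fixes U :: "'a::euclidean_space \<Rightarrow> 'a" and xs :: 'a and q c\<^sub>1 c\<^sub>2 \<kappa>\<^sub>1 \<kappa>\<^sub>2 :: real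
  assumes q: "0 \<le> q" "q < 1"
    and contraction: "\<And>x y. norm (U x - U y) \<le> q * norm (x - y)"
    and fixpoint: "U xs = xs"
    and c: "c\<^sub>1 > 0" "c\<^sub>2 > 0"
    and \<kappa>: "0 < \<kappa>\<^sub>1" "\<kappa>\<^sub>1 < 1" "\<kappa>\<^sub>2 > 1"
begin

section \<open>The residual and the scaled vector field\<close>

definition R :: "'a \<Rightarrow> 'a" where "R x = x - U x"

definition \<phi> :: "'a \<Rightarrow> real" where "\<phi> = scaling c\<^sub>1 c\<^sub>2 \<kappa>\<^sub>1 \<kappa>\<^sub>2 U"

definition G :: "'a \<Rightarrow> 'a" where "G x = - (\<phi> x *\<^sub>R R x)"

text \<open>The factor \<open>2 * (1 - q)\<close> of both rates comes from strong monotonicity of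
  \<open>R\<close>. The powers come from bounding \<open>norm (R x)\<close> by the distance to
  \<open>xs\<close>: above with factor 2 for the negative exponent
  \<open>\<kappa>\<^sub>1 - 1\<close>, below with factor \<open>1 - q\<close> for the positive
  exponent \<open>\<kappa>\<^sub>2 - 1\<close>.\<close>

definition p\<^sub>1 :: real where "p\<^sub>1 = 2 * (1 - q) * (c\<^sub>1 * 2 powr (\<kappa>\<^sub>1 - 1))"

definition p\<^sub>2 :: real where "p\<^sub>2 = 2 * (1 - q) * (c\<^sub>2 * (1 - q) powr (\<kappa>\<^sub>2 - 1))"

lemma p_pos: "p\<^sub>1 > 0" "p\<^sub>2 > 0"
  using q c by (simp_all add: p\<^sub>1_def p\<^sub>2_def)

lemma R_monotone: "(1 - q) * (norm (x - y))\<^sup>2 \<le> (x - y) \<bullet> (R x - R y)"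
proof -
  have "(x - y) \<bullet> (U x - U y) \<le> norm (x - y) * norm (U x - U y)"
    by (rule norm_cauchy_schwarz)
  also have "\<dots> \<le> norm (x - y) * (q * norm (x - y))"
    by (intro mult_left_mono contraction) simp
  finally have "(x - y) \<bullet> (U x - U y) \<le> q * (norm (x - y))\<^sup>2"
    by (simp add: power2_eq_square algebra_simps)
  moreover have "(x - y) \<bullet> (R x - R y) = (norm (x - y))\<^sup>2 - (x - y) \<bullet> (U x - U y)"
    by (simp add: R_def power2_norm_eq_inner algebra_simps)
  ultimately show ?thesis
    by (simp add: algebra_simps)
qed

lemma R_xs [simp]: "R xs = 0"
  by (simp add: R_def fixpoint)

lemma norm_R_lower: "(1 - q) * norm (x - xs) \<le> norm (R x)"
proof -
  have "norm (x - xs) \<le> norm (x - U x) + norm (U x - U xs)"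
    using norm_triangle_ineq[of "x - U x" "U x - U xs"] by (simp add: fixpoint)
  with contraction[of x xs] show ?thesis
    by (simp add: R_def algebra_simps)
qed

lemma norm_R_upper: "norm (R x) \<le> 2 * norm (x - xs)"
proof -
  have "norm (x - U x) \<le> norm (x - xs) + norm (U x - U xs)"
    using norm_triangle_ineq4[of "x - xs" "U x - U xs"] by (simp add: fixpoint)
  moreover have "q * norm (x - xs) \<le> 1 * norm (x - xs)"
    using q by (intro mult_right_mono) auto
  ultimately show ?thesis
    using contraction[of x xs] by (simp add: R_def)
qed

lemma R_eq_0_iff: "R x = 0 \<longleftrightarrow> x = xs"
proof
  assume "R x = 0"
  then have "(1 - q) * norm (x - xs) \<le> 0"
    using norm_R_lower[of x] by simp
  then show "x = xs"
    using q by (simp add: mult_le_0_iff)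
qed simp

lemma R_continuous: "continuous_on S R"
proof -
  have "q-lipschitz_on S U"
    using q contraction by (intro lipschitz_onI) (auto simp: dist_norm)
  then have "continuous_on S U"
    by (rule lipschitz_on_continuous_on)
  then show ?thesis
    unfolding R_def by (intro continuous_intros)
qed

lemma \<phi>_eq:
  assumes "x \<noteq> xs"
  shows "\<phi> x = c\<^sub>1 * norm (R x) powr (\<kappa>\<^sub>1 - 1) + c\<^sub>2 * norm (R x) powr (\<kappa>\<^sub>2 - 1)"
proof -
  have "x \<notin> Fix U"
    using assms R_eq_0_iff[of x] by (auto simp: Fix_def R_def)
  then show ?thesis
    using powr_minus_divide[of "norm (R x)" "1 - \<kappa>\<^sub>1"] powr_minus_divide[of "norm (R x)" "1 - \<kappa>\<^sub>2"]
    by (simp add: \<phi>_def scaling_def R_def)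
qed

lemma \<phi>_pos:
  assumes "x \<noteq> xs"
  shows "\<phi> x > 0"
  using assms c by (simp add: \<phi>_eq R_eq_0_iff add_pos_pos)

lemma \<phi>_nonneg: "\<phi> x \<ge> 0"
  using c by (simp add: \<phi>_def scaling_def)

lemma \<phi>_continuous: "continuous_on (- {xs}) \<phi>"
proof -
  have "continuous_on (- {xs}) (\<lambda>x. c\<^sub>1 * norm (R x) powr (\<kappa>\<^sub>1 - 1) + c\<^sub>2 * norm (R x) powr (\<kappa>\<^sub>2 - 1))"
    by (intro continuous_intros R_continuous) (auto simp: R_eq_0_iff)
  then show ?thesis
    by (subst continuous_on_cong[OF refl \<phi>_eq]) auto
qed

lemma G_xs [simp]: "G xs = 0"
  by (simp add: G_def)

lemma G_continuous: "continuous_on UNIV G"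
proof -
  define K where "K \<kappa> x = norm (R x) powr (\<kappa> - 1) *\<^sub>R R x" for \<kappa> x
  have K: "continuous_on UNIV (K \<kappa>)" if "\<kappa> > 0" for \<kappa>
    unfolding K_def using R_continuous that by (rule norm_powr_scaleR_continuous)
  \<comment> \<open>Distributing \<open>R\<close> over the sum absorbs the singular factor into a
    continuous term; at \<open>xs\<close> both sides vanish.\<close>
  have "G = (\<lambda>x. - (c\<^sub>1 *\<^sub>R K \<kappa>\<^sub>1 x + c\<^sub>2 *\<^sub>R K \<kappa>\<^sub>2 x))"
  proof
    show "G x = - (c\<^sub>1 *\<^sub>R K \<kappa>\<^sub>1 x + c\<^sub>2 *\<^sub>R K \<kappa>\<^sub>2 x)" for x
      by (cases "x = xs") (simp_all add: G_def K_def \<phi>_eq algebra_simps)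
  qed
  moreover have "continuous_on UNIV (\<lambda>x. - (c\<^sub>1 *\<^sub>R K \<kappa>\<^sub>1 x + c\<^sub>2 *\<^sub>R K \<kappa>\<^sub>2 x))"
    using \<kappa> by (intro continuous_intros K) auto
  ultimately show ?thesis
    by simp
qed

text \<open>Both curves share the speed \<open>k u\<close> as a function of time, so monotonicity of
  \<open>R\<close> suffices although the speed \<phi> of \<open>G\<close> depends on the point. With
  \<open>w\<close> constantly \<open>xs\<close> this gives stability; with \<open>w\<close> a
  time-changed flow it gives uniqueness.\<close>

lemma distance_nonincreasing:
  assumes "s \<le> t" and cont: "continuous_on {s..t} z" "continuous_on {s..t} w"
    and k: "\<And>u. u \<in> {s<..<t} \<Longrightarrow> k u \<ge> 0"
    and z: "\<And>u. u \<in> {s<..<t} \<Longrightarrow> (z has_vector_derivative - (k u *\<^sub>R R (z u))) (at u)"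
    and w: "\<And>u. u \<in> {s<..<t} \<Longrightarrow> (w has_vector_derivative - (k u *\<^sub>R R (w u))) (at u)"
  shows "norm (z t - w t) \<le> norm (z s - w s)"
proof -
  have "(norm (z t - w t))\<^sup>2 \<le> (norm (z s - w s))\<^sup>2"
  proof (rule DERIV_nonpos_imp_decreasing_open[OF \<open>s \<le> t\<close>, of "\<lambda>u. (norm (z u - w u))\<^sup>2"])
    fix u assume "s < u" "u < t"
    then have u: "u \<in> {s<..<t}" by simp
    let ?d = "2 * ((z u - w u) \<bullet> (- (k u *\<^sub>R R (z u)) - - (k u *\<^sub>R R (w u))))"
    have "((\<lambda>u. (norm (z u - w u))\<^sup>2) has_real_derivative ?d) (at u)"
      by (intro has_real_derivative_norm_sq has_vector_derivative_diff z w u)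
    moreover have "0 \<le> (z u - w u) \<bullet> (R (z u) - R (w u))"
      using R_monotone[of "z u" "w u"] q by (smt (verit) mult_nonneg_nonneg zero_le_power2)
    then have "0 \<le> k u * ((z u - w u) \<bullet> (R (z u) - R (w u)))"
      using k[OF u] by simp
    then have "?d \<le> 0"
      by (simp add: inner_diff_right algebra_simps)
    ultimately show "\<exists>y. ((\<lambda>u. (norm (z u - w u))\<^sup>2) has_real_derivative y) (at u) \<and> y \<le> 0"
      by blast
  qed (intro continuous_intros cont)
  then show ?thesis
    by (rule power2_le_imp_le) simp
qed

lemma solution_distance_nonincreasing:
  assumes z: "solution G x0 z" and st: "0 \<le> s" "s \<le> t"
  shows "norm (z t - xs) \<le> norm (z s - xs)"
proof (rule distance_nonincreasing[OF st(2), where w = "\<lambda>_. xs" and k = "\<lambda>u. \<phi> (z u)"])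
  show "continuous_on {s..t} z"
    using solution_continuous_on[OF z] by (rule continuous_on_subset) (use st in auto)
  show "(z has_vector_derivative - (\<phi> (z u) *\<^sub>R R (z u))) (at u)" if "u \<in> {s<..<t}" for u
    using solution_derivative_at[OF z, of u] that st by (simp add: G_def)
qed (auto simp: \<phi>_nonneg)

text \<open>Strong monotonicity gives a factor \<open>r\<^sup>2\<close>, and the two bounds on
  \<open>norm (R x)\<close> estimate \<phi> from below by powers
  \<open>r powr (\<kappa> - 1)\<close>. The product \<open>r powr (\<kappa> + 1)\<close> is the
  power \<open>(1 + \<kappa>) / 2\<close> of the squared distance.\<close>

lemma lyapunov_decay:
  assumes "x \<noteq> xs"
  shows "2 * ((x - xs) \<bullet> G x) \<le> - (p\<^sub>1 * ((norm (x - xs))\<^sup>2) powr ((1 + \<kappa>\<^sub>1) / 2)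
    + p\<^sub>2 * ((norm (x - xs))\<^sup>2) powr ((1 + \<kappa>\<^sub>2) / 2))"
proof -
  define r where "r = norm (x - xs)"
  have r: "r > 0" using assms by (simp add: r_def)
  have R: "norm (R x) > 0" using assms by (simp add: R_eq_0_iff)
  have sq: "(r\<^sup>2) powr ((1 + \<kappa>) / 2) = r powr (\<kappa> - 1) * r\<^sup>2" for \<kappa>
  proof -
    have "r\<^sup>2 = r powr 2" using r by simp
    then have "(r\<^sup>2) powr ((1 + \<kappa>) / 2) = r powr (2 * ((1 + \<kappa>) / 2))"
      by (simp only: powr_powr)
    also have "2 * ((1 + \<kappa>) / 2) = (\<kappa> - 1) + 2" by simp
    finally show ?thesis
      using r by (simp only: powr_add \<open>r\<^sup>2 = r powr 2\<close>)
  qed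
  have "(2 * r) powr (\<kappa>\<^sub>1 - 1) \<le> norm (R x) powr (\<kappa>\<^sub>1 - 1)"
    using norm_R_upper[of x] R \<kappa> by (intro powr_mono2') (auto simp: r_def)
  then have 1: "c\<^sub>1 * (2 powr (\<kappa>\<^sub>1 - 1) * r powr (\<kappa>\<^sub>1 - 1)) \<le> c\<^sub>1 * norm (R x) powr (\<kappa>\<^sub>1 - 1)"
    using c r by (simp add: powr_mult)
  have "((1 - q) * r) powr (\<kappa>\<^sub>2 - 1) \<le> norm (R x) powr (\<kappa>\<^sub>2 - 1)"
    using norm_R_lower[of x] q r \<kappa> by (intro powr_mono2) (auto simp: r_def)
  then have 2: "c\<^sub>2 * ((1 - q) powr (\<kappa>\<^sub>2 - 1) * r powr (\<kappa>\<^sub>2 - 1)) \<le> c\<^sub>2 * norm (R x) powr (\<kappa>\<^sub>2 - 1)"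
    using c r q by (simp add: powr_mult)
  have "p\<^sub>1 * (r\<^sup>2) powr ((1 + \<kappa>\<^sub>1) / 2) + p\<^sub>2 * (r\<^sup>2) powr ((1 + \<kappa>\<^sub>2) / 2)
      = 2 * ((1 - q) * r\<^sup>2) * (c\<^sub>1 * (2 powr (\<kappa>\<^sub>1 - 1) * r powr (\<kappa>\<^sub>1 - 1))
        + c\<^sub>2 * ((1 - q) powr (\<kappa>\<^sub>2 - 1) * r powr (\<kappa>\<^sub>2 - 1)))"
    by (simp add: sq p\<^sub>1_def p\<^sub>2_def algebra_simps)
  also have "\<dots> \<le> 2 * ((1 - q) * r\<^sup>2) * \<phi> x"
    using 1 2 q by (intro mult_left_mono) (auto simp: \<phi>_eq[OF assms])
  also have "\<dots> \<le> 2 * ((x - xs) \<bullet> R x) * \<phi> x"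
    using R_monotone[of x xs] \<phi>_pos[OF assms] by (intro mult_right_mono) (auto simp: r_def)
  finally show ?thesis
    by (simp add: G_def r_def mult_ac)
qed

section \<open>Time spent away from the equilibrium\<close>

context
  fixes x :: "real \<Rightarrow> 'a" and b :: real
  assumes b: "0 \<le> b" and cont: "continuous_on {0..b} x"
    and ne: "\<And>t. t \<in> {0..b} \<Longrightarrow> x t \<noteq> xs"
    and der: "\<And>t. t \<in> {0<..<b} \<Longrightarrow> (x has_vector_derivative G (x t)) (at t)"
begin

private abbreviation (input) "V \<equiv> \<lambda>t. (norm (x t - xs))\<^sup>2"

private lemma V_cont: "continuous_on {0..b} V"
  by (intro continuous_intros cont)

private lemma V_pos: "t \<in> {0..b} \<Longrightarrow> V t > 0"
  using ne by simp

private lemma V_der: "t \<in> {0<..<b} \<Longrightarrow> (V has_real_derivative 2 * ((x t - xs) \<bullet> G (x t))) (at t)"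
  using has_real_derivative_norm_sq[OF has_vector_derivative_diff[OF der has_vector_derivative_const]]
  by simp

text \<open>Stated for curves on a bounded interval because it first bounds the clock of the
  time-changed flow, before a solution on the half line is available, and later the settling
  time.\<close>

lemma nonequilibrium_time_bound:
  "b \<le> 1 / (p\<^sub>1 * (1 - (1 + \<kappa>\<^sub>1) / 2)) + 1 / (p\<^sub>2 * ((1 + \<kappa>\<^sub>2) / 2 - 1))"
  by (rule fixed_time_bound[OF b V_cont V_pos V_der lyapunov_decay])
    (use ne p_pos \<kappa> in auto)

lemma nonequilibrium_time_bound_pi:
  assumes "\<xi> > 0" "(1 + \<kappa>\<^sub>1) / 2 = 1 - 1 / (2 * \<xi>)" "(1 + \<kappa>\<^sub>2) / 2 = 1 + 1 / (2 * \<xi>)"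
  shows "b \<le> pi * \<xi> / sqrt (p\<^sub>1 * p\<^sub>2)"
proof (rule fixed_time_bound_pi[OF b V_cont V_pos V_der _ p_pos assms(1)])
  fix t assume "t \<in> {0<..<b}"
  then have "x t \<noteq> xs"
    using ne by auto
  from lyapunov_decay[OF this] show "2 * ((x t - xs) \<bullet> G (x t)) \<le>
      - (p\<^sub>1 * V t powr (1 - 1 / (2 * \<xi>)) + p\<^sub>2 * V t powr (1 + 1 / (2 * \<xi>)))"
    unfolding assms(2,3) .
qed auto

end

end

section \<open>Existence and uniqueness of solutions by a change of time\<close>

locale fixed_point_flow = contraction_dynamics +
  fixes x0 :: 'a and y :: "real \<Rightarrow> 'a"
  assumes x0: "x0 \<noteq> xs" and y_0: "y 0 = x0" and y_cont: "continuous_on UNIV y"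
    and y_der: "\<And>s. s > 0 \<Longrightarrow> (y has_vector_derivative - R (y s)) (at s)"
begin

text \<open>The weight is used with \<open>k = 2 * (1 - q)\<close> for exponential decay and with
  \<open>k = 4\<close> for the lower bound that keeps \<open>y\<close> off
  \<open>xs\<close>.\<close>

lemma y_weighted_derivative:
  assumes "s > 0"
  shows "((\<lambda>s. (norm (y s - xs))\<^sup>2 * exp (k * s)) has_real_derivative
    (k * (norm (y s - xs))\<^sup>2 - 2 * ((y s - xs) \<bullet> R (y s))) * exp (k * s)) (at s)"
proof -
  have N: "((\<lambda>s. (norm (y s - xs))\<^sup>2) has_real_derivative 2 * ((y s - xs) \<bullet> - R (y s))) (at s)"
    using has_real_derivative_norm_sq[OF has_vector_derivative_diff[OF y_der has_vector_derivative_const]]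
      assms by simp
  have "((\<lambda>s. exp (k * s)) has_real_derivative exp (k * s) * k) (at s)"
    by (auto intro!: derivative_eq_intros)
  from DERIV_mult[OF N this] show ?thesis
    by (simp add: algebra_simps)
qed

lemma y_weighted_continuous: "continuous_on S (\<lambda>s. (norm (y s - xs))\<^sup>2 * exp (k * s))"
  by (intro continuous_intros continuous_on_subset[OF y_cont]) auto

lemma y_decay:
  assumes "s \<ge> 0"
  shows "(norm (y s - xs))\<^sup>2 \<le> (norm (x0 - xs))\<^sup>2 * exp (- (2 * (1 - q) * s))"
proof -
  let ?k = "2 * (1 - q)"
  have "(norm (y s - xs))\<^sup>2 * exp (?k * s) \<le> (norm (y 0 - xs))\<^sup>2 * exp (?k * 0)"
  proof (rule DERIV_nonpos_imp_decreasing_open[OF assms, of "\<lambda>s. (norm (y s - xs))\<^sup>2 * exp (?k * s)"])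
    fix u :: real assume "0 < u"
    moreover have "(?k * (norm (y u - xs))\<^sup>2 - 2 * ((y u - xs) \<bullet> R (y u))) * exp (?k * u) \<le> 0"
      using R_monotone[of "y u" xs] by (intro mult_nonpos_nonneg) (auto simp: algebra_simps)
    ultimately show "\<exists>d. ((\<lambda>s. (norm (y s - xs))\<^sup>2 * exp (?k * s)) has_real_derivative d) (at u) \<and> d \<le> 0"
      using y_weighted_derivative[of u ?k] by blast
  qed (rule y_weighted_continuous)
  from mult_right_mono[OF this, of "exp (- (?k * s))"] show ?thesis
    by (simp add: y_0 mult.assoc flip: exp_add)
qed

text \<open>Since \<open>norm (R x)\<close> is at most twice the distance to \<open>xs\<close>, the
  squared distance decays no faster than \<open>exp (- 4 * s)\<close>. Hence \<phi> stays positive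
  along \<open>y\<close> and the clock is defined for all parameters.\<close>

lemma y_neq_xs:
  assumes "s \<ge> 0"
  shows "y s \<noteq> xs"
proof -
  have "(norm (y 0 - xs))\<^sup>2 * exp (4 * 0) \<le> (norm (y s - xs))\<^sup>2 * exp (4 * s)"
  proof (rule DERIV_nonneg_imp_increasing_open[OF assms, of "\<lambda>s. (norm (y s - xs))\<^sup>2 * exp (4 * s)"])
    fix u :: real assume "0 < u"
    moreover have "(y u - xs) \<bullet> R (y u) \<le> norm (y u - xs) * (2 * norm (y u - xs))"
      using norm_cauchy_schwarz[of "y u - xs" "R (y u)"]
        mult_left_mono[OF norm_R_upper[of "y u"] norm_ge_zero[of "y u - xs"]] by linarith
    then have "0 \<le> (4 * (norm (y u - xs))\<^sup>2 - 2 * ((y u - xs) \<bullet> R (y u))) * exp (4 * u)"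
      by (intro mult_nonneg_nonneg) (auto simp: power2_eq_square)
    ultimately show "\<exists>d. ((\<lambda>s. (norm (y s - xs))\<^sup>2 * exp (4 * s)) has_real_derivative d) (at u) \<and> 0 \<le> d"
      using y_weighted_derivative[of u 4] by blast
  qed (rule y_weighted_continuous)
  then have "0 < (norm (y s - xs))\<^sup>2 * exp (4 * s)"
    using x0 by (simp add: y_0 less_le_trans[rotated])
  then show ?thesis
    by (metis mult_zero_left norm_zero power_zero_numeral right_minus_eq less_irrefl)
qed

lemma y_tendsto: "(y \<longlongrightarrow> xs) at_top"
proof -
  have "filterlim (\<lambda>s. 2 * (1 - q) * s) at_top at_top"
    using q by (intro filterlim_tendsto_pos_mult_at_top[OF tendsto_const] filterlim_ident) auto
  then have "((\<lambda>s. exp (- (2 * (1 - q) * s))) \<longlongrightarrow> 0) at_top"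
    by (intro filterlim_compose[OF exp_at_bot]) (simp add: filterlim_uminus_at_bot)
  then have "((\<lambda>s. (norm (x0 - xs))\<^sup>2 * exp (- (2 * (1 - q) * s))) \<longlongrightarrow> 0) at_top"
    by (rule tendsto_mult_right_zero)
  then have "((\<lambda>s. (norm (y s - xs))\<^sup>2) \<longlongrightarrow> 0) at_top"
    by (rule Lim_null_comparison[rotated])
      (use y_decay in \<open>auto intro!: eventually_at_top_linorderI[of 0]\<close>)
  then have "((\<lambda>s. sqrt ((norm (y s - xs))\<^sup>2)) \<longlongrightarrow> sqrt 0) at_top"
    by (rule tendsto_real_sqrt)
  then show ?thesis
    by (simp add: LIM_zero_iff tendsto_norm_zero_iff)
qed

lemma y_distance_nonincreasing:
  assumes "0 \<le> r" "r \<le> s"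
  shows "norm (y s - xs) \<le> norm (y r - xs)"
proof (rule distance_nonincreasing[OF assms(2), where w = "\<lambda>_. xs" and k = "\<lambda>_. 1"])
  show "continuous_on {r..s} y"
    using y_cont by (rule continuous_on_subset) simp
qed (use y_der assms in auto)

end

text \<open>The \<open>max 0 s\<close> continues the clock to negative parameters with constant
  slope, so \<tau> is differentiable and strictly increasing on the whole line and its inverse is
  differentiable at \<open>\<tau> 0\<close> as well.\<close>

locale reparametrized_flow = fixed_point_flow +
  fixes \<tau> :: "real \<Rightarrow> real"
  assumes \<tau>_0: "\<tau> 0 = 0"
    and \<tau>_der: "\<And>s. (\<tau> has_real_derivative 1 / \<phi> (y (max 0 s))) (at s)"
begin

section \<open>The clock and its inverse\<close>

lemma \<tau>_strict_mono: "strict_mono \<tau>"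
proof (rule strict_monoI)
  fix r s :: real assume "r < s"
  then show "\<tau> r < \<tau> s"
  proof (rule DERIV_pos_imp_increasing)
    fix u
    have "1 / \<phi> (y (max 0 u)) > 0"
      using \<phi>_pos y_neq_xs[of "max 0 u"] by simp
    then show "\<exists>d. (\<tau> has_real_derivative d) (at u) \<and> 0 < d"
      using \<tau>_der by blast
  qed
qed

lemma \<tau>_cont: "continuous_on S \<tau>"
  using \<tau>_der by (intro continuous_at_imp_continuous_on) (blast intro: DERIV_isCont)

text \<open>The clock is bounded above, so its inverse is meaningful on the range of \<tau> only;
  the facts about it are stated at points \<open>\<tau> s\<close>.\<close>

definition \<sigma> :: "real \<Rightarrow> real" where "\<sigma> = inv \<tau>"

lemma \<sigma>_\<tau> [simp]: "\<sigma> (\<tau> s) = s"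
  using \<tau>_strict_mono by (simp add: \<sigma>_def strict_mono_imp_inj_on)

lemma \<sigma>_der: "(\<sigma> has_real_derivative \<phi> (y (max 0 s))) (at (\<tau> s))"
proof -
  have "\<phi> (y (max 0 s)) > 0"
    using \<phi>_pos y_neq_xs[of "max 0 s"] by simp
  then have id: "(*) (1 / \<phi> (y (max 0 s))) \<circ> (*) (\<phi> (y (max 0 s))) = id"
    by auto
  show ?thesis
    unfolding has_field_derivative_def
    by (rule has_derivative_inverse_strong[OF open_UNIV UNIV_I \<tau>_cont \<sigma>_\<tau>
          \<tau>_der[unfolded has_field_derivative_def] id])
qed

lemma \<tau>_image:
  assumes "t \<in> {0..\<tau> s}"
  obtains r where "t = \<tau> r" "0 \<le> r" "r \<le> s"
proof -
  have "0 \<le> s"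
    using assms strict_mono_less_eq[OF \<tau>_strict_mono, of 0 s] \<tau>_0 by simp
  then show ?thesis
    using IVT'[of \<tau> 0 t s] assms \<tau>_0 \<tau>_cont that by auto
qed

lemma y_\<sigma>_isCont: "isCont (\<lambda>t. y (\<sigma> t)) (\<tau> s)"
  using y_cont by (intro isCont_o2[OF DERIV_isCont[OF \<sigma>_der]])
    (simp add: continuous_on_eq_continuous_at)

lemma y_\<sigma>_derivative:
  assumes "s > 0"
  shows "((\<lambda>t. y (\<sigma> t)) has_vector_derivative G (y s)) (at (\<tau> s))"
proof -
  have "(\<sigma> has_vector_derivative \<phi> (y s)) (at (\<tau> s))"
    using \<sigma>_der[of s] assms by (simp add: has_real_derivative_iff_has_vector_derivative)
  moreover have "(y has_vector_derivative - R (y s)) (at (\<sigma> (\<tau> s)))"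
    using y_der[OF assms] by simp
  ultimately have "(y \<circ> \<sigma> has_vector_derivative \<phi> (y s) *\<^sub>R - R (y s)) (at (\<tau> s))"
    by (rule vector_diff_chain_at)
  then show ?thesis
    by (simp add: o_def G_def)
qed

text \<open>On \<open>{0..\<tau> s}\<close> the curve \<open>y (\<sigma> t)\<close> follows
  \<open>G\<close> and avoids \<open>xs\<close>, so the Lyapunov time bound limits
  \<open>\<tau> s\<close> independently of \<open>s\<close>.\<close>

lemma \<tau>_bounded: "bdd_above (range \<tau>)"
proof -
  let ?B = "1 / (p\<^sub>1 * (1 - (1 + \<kappa>\<^sub>1) / 2)) + 1 / (p\<^sub>2 * ((1 + \<kappa>\<^sub>2) / 2 - 1))"
  have nonneg: "\<tau> s \<le> ?B" if s: "s \<ge> 0" for s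
  proof (rule nonequilibrium_time_bound[where x = "\<lambda>t. y (\<sigma> t)"])
    show "0 \<le> \<tau> s"
      using s strict_mono_less_eq[OF \<tau>_strict_mono, of 0 s] \<tau>_0 by simp
    show "continuous_on {0..\<tau> s} (\<lambda>t. y (\<sigma> t))"
      by (intro continuous_at_imp_continuous_on ballI) (erule \<tau>_image, simp only: y_\<sigma>_isCont)
    show "y (\<sigma> t) \<noteq> xs" if "t \<in> {0..\<tau> s}" for t
      using that by (rule \<tau>_image) (simp add: y_neq_xs)
    show "((\<lambda>t. y (\<sigma> t)) has_vector_derivative G (y (\<sigma> t))) (at t)" if "t \<in> {0<..<\<tau> s}" for t
    proof -
      from that have "t \<in> {0..\<tau> s}" by simp
      then obtain r where r: "t = \<tau> r" "0 \<le> r" "r \<le> s"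
        by (rule \<tau>_image)
      with that \<tau>_0 have "r > 0"
        by (cases "r = 0") auto
      with r show ?thesis
        using y_\<sigma>_derivative by simp
    qed
  qed
  have "\<tau> s \<le> ?B" for s
  proof -
    have "\<tau> s \<le> \<tau> (max 0 s)"
      using strict_mono_less_eq[OF \<tau>_strict_mono] by simp
    also have "\<dots> \<le> ?B"
      by (rule nonneg) simp
    finally show ?thesis .
  qed
  then show ?thesis
    by (intro bdd_aboveI) auto
qed

section \<open>A trajectory arriving at the equilibrium in finite time\<close>

definition T :: real where "T = (SUP s. \<tau> s)"

lemma \<tau>_less_T: "\<tau> s < T"
proof -
  have "\<tau> s < \<tau> (s + 1)"
    using \<tau>_strict_mono by (simp add: strict_mono_less)
  also have "\<dots> \<le> T"
    unfolding T_def by (intro cSUP_upper \<tau>_bounded) simp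
  finally show ?thesis .
qed

lemma T_pos: "T > 0"
  using \<tau>_less_T[of 0] \<tau>_0 by simp

lemma less_T_image:
  assumes "0 \<le> t" "t < T"
  obtains s where "t = \<tau> s" "s \<ge> 0"
proof -
  obtain s where "t < \<tau> s"
    using assms(2) less_cSUP_iff[OF _ \<tau>_bounded] by (auto simp: T_def)
  then show ?thesis
    using assms(1) \<tau>_image[of t s] that by force
qed

definition trajectory :: "real \<Rightarrow> 'a" where
  "trajectory t = (if t < T then y (\<sigma> t) else xs)"

lemma trajectory_isCont:
  assumes "t \<ge> 0"
  shows "isCont trajectory t"
proof (cases t T rule: linorder_cases)
  case less
  then obtain s where s: "t = \<tau> s"
    using less_T_image[OF assms] by blast
  have ev: "\<forall>\<^sub>F u in nhds t. trajectory u = y (\<sigma> u)"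
    using less by (intro eventually_nhds_in_open[THEN eventually_mono, of "{..<T}"])
      (auto simp: trajectory_def)
  then show ?thesis
    using y_\<sigma>_isCont[of s] s isCont_cong[OF ev] by simp
next
  case greater
  then have "\<forall>\<^sub>F u in nhds t. trajectory u = xs"
    by (intro eventually_nhds_in_open[THEN eventually_mono, of "{T<..}"])
      (auto simp: trajectory_def)
  then show ?thesis
    using isCont_cong[of trajectory "\<lambda>_. xs" t] by simp
next
  case equal
  \<comment> \<open>A time \<open>u\<close> with \<open>\<tau> N < u < T\<close> corresponds to a
    flow parameter beyond \<open>N\<close>, and \<open>y\<close> tends to \<open>xs\<close> at
    infinity; from \<open>T\<close> on the curve is constant.\<close>
  have "(trajectory \<longlongrightarrow> xs) (at T)"
  proof (rule tendstoI)
    fix e :: real assume "e > 0"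
    then obtain N where N: "\<And>s. s \<ge> N \<Longrightarrow> dist (y s) xs < e"
      using tendstoD[OF y_tendsto] by (auto simp: eventually_at_top_linorder)
    let ?N = "max 0 N"
    have "dist (trajectory u) xs < e" if u: "\<tau> ?N < u" for u
    proof (cases "u < T")
      case True
      have "0 \<le> u"
        using u strict_mono_less_eq[OF \<tau>_strict_mono, of 0 ?N] \<tau>_0 by simp
      with True obtain s where s: "u = \<tau> s"
        using less_T_image by blast
      with u have "?N < s"
        using strict_mono_less[OF \<tau>_strict_mono] by blast
      with N[of s] True s show ?thesis
        by (simp add: trajectory_def)
    qed (simp add: trajectory_def \<open>e > 0\<close>)
    moreover have "\<forall>\<^sub>F u in at T. u \<in> {\<tau> ?N<..}"
      by (rule eventually_at_in_open') (use \<tau>_less_T in auto)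
    ultimately show "\<forall>\<^sub>F u in at T. dist (trajectory u) xs < e"
      by (auto elim: eventually_mono)
  qed
  then show ?thesis
    using equal by (simp add: isCont_def trajectory_def)
qed

lemma trajectory_solution: "solution G x0 trajectory"
proof -
  have "trajectory 0 = y (\<sigma> (\<tau> 0))"
    using T_pos by (simp add: trajectory_def \<tau>_0)
  then have 0: "trajectory 0 = x0"
    by (simp add: y_0)
  have "solution G (trajectory 0) trajectory"
  \<comment> \<open>Only the gluing time is exceptional; beyond it the constant curve solves the
    equation because \<open>G xs = 0\<close>.\<close>
  proof (rule solutionI[where S = "{T}"])
    show "continuous_on {0..} trajectory"
      by (intro continuous_at_imp_continuous_on) (simp add: trajectory_isCont)
    show "continuous_on UNIV G"
      by (rule G_continuous)
    fix t :: real assume t: "t > 0" "t \<notin> {T}"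
    show "(trajectory has_vector_derivative G (trajectory t)) (at t)"
    proof (cases "t < T")
      case True
      then obtain s where s: "t = \<tau> s" "s \<ge> 0"
        using t less_T_image[of t] by auto
      then have "s > 0"
        using t \<tau>_0 by (cases "s = 0") auto
      from y_\<sigma>_derivative[OF this]
      have "((\<lambda>t. y (\<sigma> t)) has_vector_derivative G (trajectory t)) (at t)"
        using True s by (simp add: trajectory_def)
      then show ?thesis
        by (rule has_vector_derivative_transform_within_open[of _ _ _ "{..<T}"])
          (use True in \<open>auto simp: trajectory_def\<close>)
    next
      case False
      then have "t \<in> {T<..}"
        using t by simp
      have "((\<lambda>_. xs) has_vector_derivative G (trajectory t)) (at t)"
        using False by (simp add: trajectory_def)
      then show ?thesis
        by (rule has_vector_derivative_transform_within_open[OF _ open_greaterThan \<open>t \<in> {T<..}\<close>])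
          (simp add: trajectory_def)
    qed
  qed simp
  with 0 show ?thesis by simp
qed

text \<open>The integral \<open>h\<close> of \<phi> along \<open>z\<close> is the inverse clock read
  off from \<open>z\<close> itself. Both \<open>z\<close> and \<open>y\<close> run at
  \<open>h\<close> are driven by \<open>R\<close> with speed \<open>\<phi> (z t)\<close> and start
  at \<open>x0\<close>, so they coincide. Then the derivative of \<open>\<tau> (h t)\<close> is
  \<open>\<phi> (z t) / \<phi> (y (h t)) = 1\<close>, whence
  \<open>\<tau> (h b) = b\<close>.\<close>

lemma solution_before_hitting:
  assumes z: "solution G x0 z" and b: "0 \<le> b"
    and ne: "\<And>t. t \<in> {0..b} \<Longrightarrow> z t \<noteq> xs"
  obtains s where "s \<ge> 0" "\<tau> s = b" "y s = z b"
proof (cases "b = 0")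
  case True
  with that[of 0] show ?thesis
    using z by (simp add: \<tau>_0 y_0 solution_def)
next
  case False
  with b have b: "0 < b" by simp
  have z_cont: "continuous_on {0..b} z"
    using solution_continuous_on[OF z] by (rule continuous_on_subset) auto
  have \<phi>z: "continuous_on {0..b} (\<lambda>t. \<phi> (z t))"
    by (rule continuous_on_compose2[OF \<phi>_continuous z_cont]) (use ne in force)
  define h where "h t = integral {0..t} (\<lambda>t. \<phi> (z t))" for t
  have h_within: "(h has_real_derivative \<phi> (z t)) (at t within {0..b})" if "t \<in> {0..b}" for t
    unfolding h_def using \<phi>z that by (rule integral_has_real_derivative)
  have h_der: "(h has_real_derivative \<phi> (z t)) (at t)" if "t \<in> {0<..<b}" for t
    using h_within[of t] that at_within_Icc_at[of 0 t b] by auto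
  have h_cont: "continuous_on {0..b} h"
    using h_within by (rule DERIV_continuous_on)
  have h_0: "h 0 = 0"
    by (simp add: h_def)
  have h_pos: "h t > 0" if t: "t \<in> {0<..b}" for t
  proof -
    have "h 0 < h t"
    proof (rule DERIV_pos_imp_increasing_open[of 0 t h])
      show "\<exists>d. (h has_real_derivative d) (at u) \<and> 0 < d" if "0 < u" "u < t" for u
        using h_der[of u] \<phi>_pos[OF ne[of u]] that t by auto
      show "continuous_on {0..t} h"
        using h_cont by (rule continuous_on_subset) (use t in auto)
    qed (use t in auto)
    with h_0 show ?thesis by simp
  qed
  have y_h: "z t = y (h t)" if t: "t \<in> {0..b}" for t
  proof -
    have "norm (z t - y (h t)) \<le> norm (z 0 - y (h 0))"
    proof (rule distance_nonincreasing[where w = "\<lambda>t. y (h t)" and k = "\<lambda>t. \<phi> (z t)"])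
      show "continuous_on {0..t} z"
        using z_cont by (rule continuous_on_subset) (use t in auto)
      have "continuous_on {0..t} h"
        using h_cont by (rule continuous_on_subset) (use t in auto)
      then show "continuous_on {0..t} (\<lambda>t. y (h t))"
        by (rule continuous_on_compose2[OF y_cont]) simp
      fix u assume u: "u \<in> {0<..<t}"
      show "(z has_vector_derivative - (\<phi> (z u) *\<^sub>R R (z u))) (at u)"
        using solution_derivative_at[OF z, of u] u by (simp add: G_def)
      have "(h has_vector_derivative \<phi> (z u)) (at u)"
        using h_der[of u] u t by (simp add: has_real_derivative_iff_has_vector_derivative)
      moreover have "(y has_vector_derivative - R (y (h u))) (at (h u))"
        using u t by (intro y_der h_pos) auto
      ultimately have "(y \<circ> h has_vector_derivative \<phi> (z u) *\<^sub>R - R (y (h u))) (at u)"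
        by (rule vector_diff_chain_at)
      then show "((\<lambda>t. y (h t)) has_vector_derivative - (\<phi> (z u) *\<^sub>R R (y (h u)))) (at u)"
        by (simp add: o_def)
    qed (use t in \<open>auto simp: \<phi>_nonneg\<close>)
    also have "\<dots> = 0"
      using z by (simp add: h_0 y_0 solution_def)
    finally show ?thesis by simp
  qed
  have "\<tau> (h b) - b = \<tau> (h 0) - 0"
  proof (rule DERIV_isconst_end[OF b, of "\<lambda>t. \<tau> (h t) - t"])
    have "continuous_on {0..b} (\<lambda>t. \<tau> (h t))"
      by (rule continuous_on_compose2[OF \<tau>_cont h_cont order_refl])
    then show "continuous_on {0..b} (\<lambda>t. \<tau> (h t) - t)"
      by (intro continuous_intros)
    fix u assume "0 < u" "u < b"
    then have u: "u \<in> {0<..<b}" by simp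
    have "((\<lambda>t. \<tau> (h t) - t) has_real_derivative 1 / \<phi> (y (max 0 (h u))) * \<phi> (z u) - 1) (at u)"
      by (intro DERIV_diff DERIV_ident DERIV_chain2[OF \<tau>_der h_der[OF u]])
    moreover have "max 0 (h u) = h u"
      using h_pos[of u] u by simp
    ultimately show "((\<lambda>t. \<tau> (h t) - t) has_real_derivative 0) (at u)"
      using y_h[of u] u \<phi>_pos[OF ne[of u]] by simp
  qed
  with that[of "h b"] show ?thesis
    using h_pos[of b] b y_h[of b] by (simp add: h_0 \<tau>_0)
qed

text \<open>A solution avoiding \<open>xs\<close> on \<open>{0..T}\<close> would make the clock
  attain \<open>T\<close>, which it never does; so there is a first hitting time \<open>h\<close>.
  If \<open>h = \<tau> s < T\<close>, then before \<open>h\<close> the solution takes values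
  \<open>y r\<close> with \<open>r \<le> s\<close>, no closer to \<open>xs\<close> than
  \<open>y s\<close>, and by continuity it cannot be at \<open>xs\<close> at time
  \<open>h\<close>.\<close>

lemma solution_hits_at_T:
  assumes z: "solution G x0 z"
  shows "t \<in> {0..<T} \<Longrightarrow> z t \<noteq> xs" and "z T = xs"
proof -
  have z_cont: "continuous_on {0..T} z"
    using solution_continuous_on[OF z] by (rule continuous_on_subset) auto
  define Z where "Z = {0..T} \<inter> z -` {xs}"
  have "closed Z"
    unfolding Z_def by (rule continuous_closed_preimage[OF z_cont]) auto
  moreover have "bounded Z"
    by (rule bounded_subset[of "{0..T}"]) (auto simp: Z_def)
  moreover have "Z \<noteq> {}"
  proof
    assume "Z = {}"
    then have "z t \<noteq> xs" if "t \<in> {0..T}" for t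
      using that by (auto simp: Z_def)
    with solution_before_hitting[OF z less_imp_le[OF T_pos]] obtain s where "\<tau> s = T"
      by blast
    then show False
      using \<tau>_less_T[of s] by simp
  qed
  ultimately obtain h where h: "h \<in> Z" "\<And>t. t \<in> Z \<Longrightarrow> h \<le> t"
    using compact_attains_inf[of Z] by (auto simp: compact_eq_bounded_closed)
  have before: "z t \<noteq> xs" if "0 \<le> t" "t < h" for t
    using h that by (force simp: Z_def)
  have "z 0 \<noteq> xs"
    using z x0 by (simp add: solution_def)
  with h(1) have h_pos: "h > 0"
    by (cases "h = 0") (auto simp: Z_def)
  have "h = T"
  proof (rule ccontr)
    assume "h \<noteq> T"
    with h(1) have "h < T" by (auto simp: Z_def)
    then obtain s where s: "h = \<tau> s" "s \<ge> 0"
      using h_pos less_T_image[of h] by auto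
    have lower: "norm (y s - xs) \<le> norm (z t - xs)" if t: "t \<in> {0..<h}" for t
    proof -
      obtain r where r: "r \<ge> 0" "\<tau> r = t" "y r = z t"
      proof (rule solution_before_hitting[OF z])
        show "0 \<le> t" using t by simp
        show "z u \<noteq> xs" if "u \<in> {0..t}" for u
          using before[of u] that t by simp
      qed
      then have "r \<le> s"
        using t s strict_mono_less[OF \<tau>_strict_mono, of r s] by simp
      then show ?thesis
        using y_distance_nonincreasing[OF r(1)] r(3) by metis
    qed
    have "norm (y s - xs) \<le> norm (z h - xs)"
    proof (rule continuous_ge_on_closure[where S = "{0..<h}" and f = "\<lambda>t. norm (z t - xs)"])
      show "continuous_on (closure {0..<h}) (\<lambda>t. norm (z t - xs))"
        using h_pos \<open>h < T\<close> by (intro continuous_intros continuous_on_subset[OF z_cont]) auto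
    qed (use h_pos lower in auto)
    moreover have "z h = xs"
      using h(1) by (simp add: Z_def)
    ultimately show False
      using y_neq_xs[OF s(2)] by simp
  qed
  with before h(1) show "t \<in> {0..<T} \<Longrightarrow> z t \<noteq> xs" "z T = xs"
    by (auto simp: Z_def)
qed

end

section \<open>Stability and settling time\<close>

context contraction_dynamics
begin

lemma reparametrized_flow_exists:
  assumes "x0 \<noteq> xs"
  obtains y \<tau> where "reparametrized_flow U xs q c\<^sub>1 c\<^sub>2 \<kappa>\<^sub>1 \<kappa>\<^sub>2 x0 y \<tau>"
proof -
  obtain y where "y 0 = x0" "continuous_on UNIV y"
    "\<And>s. s > 0 \<Longrightarrow> (y has_vector_derivative U (y s) - y s) (at s)"
    using contraction_flow_exists[OF q contraction] by blast
  then interpret fixed_point_flow U xs q c\<^sub>1 c\<^sub>2 \<kappa>\<^sub>1 \<kappa>\<^sub>2 x0 y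
    using assms by unfold_locales (auto simp: R_def)
  have "continuous_on UNIV (\<lambda>s. y (max 0 s))"
    by (rule continuous_on_compose2[OF y_cont]) (auto intro!: continuous_intros)
  then have "continuous_on UNIV (\<lambda>s. \<phi> (y (max 0 s)))"
    by (rule continuous_on_compose2[OF \<phi>_continuous]) (use y_neq_xs[of "max 0 _"] in force)
  then have "continuous_on UNIV (\<lambda>s. 1 / \<phi> (y (max 0 s)))"
    using \<phi>_pos[OF y_neq_xs] by (intro continuous_intros) (auto simp: less_imp_neq[symmetric])
  then obtain F where F: "\<And>s. (F has_vector_derivative 1 / \<phi> (y (max 0 s))) (at s)"
    using einterval_antiderivative[of "- \<infinity>" \<infinity> "\<lambda>s. 1 / \<phi> (y (max 0 s))"]
    by (auto simp: continuous_on_eq_continuous_at)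
  have "((\<lambda>s. F s - F 0) has_real_derivative 1 / \<phi> (y (max 0 s))) (at s)" for s
    using DERIV_diff[OF F[of s, folded has_real_derivative_iff_has_vector_derivative] DERIV_const] by simp
  then have "reparametrized_flow U xs q c\<^sub>1 c\<^sub>2 \<kappa>\<^sub>1 \<kappa>\<^sub>2 x0 y (\<lambda>s. F s - F 0)"
    by unfold_locales auto
  then show ?thesis by (rule that)
qed

lemma settling_point:
  assumes "x0 \<noteq> xs"
  shows "\<exists>T>0. (\<exists>z. solution G x0 z) \<and>
    (\<forall>z. solution G x0 z \<longrightarrow> (\<forall>t\<in>{0..<T}. z t \<noteq> xs) \<and> (z \<longlongrightarrow> xs) (at T))"
proof -
  obtain y \<tau> where "reparametrized_flow U xs q c\<^sub>1 c\<^sub>2 \<kappa>\<^sub>1 \<kappa>\<^sub>2 x0 y \<tau>"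
    using reparametrized_flow_exists[OF assms] .
  then interpret reparametrized_flow U xs q c\<^sub>1 c\<^sub>2 \<kappa>\<^sub>1 \<kappa>\<^sub>2 x0 y \<tau> .
  \<comment> \<open>The limit is two-sided: \<open>T > 0\<close> is an interior time, where
    \<open>z\<close> is continuous with value \<open>xs\<close>.\<close>
  have "(z \<longlongrightarrow> xs) (at T)" if z: "solution G x0 z" for z
    using has_vector_derivative_continuous[OF solution_derivative_at[OF z T_pos]]
      solution_hits_at_T(2)[OF z] by (simp add: continuous_within)
  then show ?thesis
    using T_pos trajectory_solution solution_hits_at_T(1) by blast
qed

text \<open>The bound \<open>B\<close> is a parameter so that both time estimates share this
  argument: for every \<open>b < T x0\<close> a solution avoids \<open>xs\<close> on
  \<open>{0..b}\<close>, and density passes \<open>b \<le> B\<close> on to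
  \<open>T x0\<close>.\<close>

lemma settling_time_bound:
  assumes T: "settling_time G xs UNIV T" and x0: "x0 \<noteq> xs"
    and B: "\<And>b x. \<lbrakk>0 \<le> b; continuous_on {0..b} x; \<And>t. t \<in> {0..b} \<Longrightarrow> x t \<noteq> xs;
      \<And>t. t \<in> {0<..<b} \<Longrightarrow> (x has_vector_derivative G (x t)) (at t)\<rbrakk> \<Longrightarrow> b \<le> B"
  shows "T x0 \<le> B"
proof -
  obtain x where x: "solution G x0 x" and T_pos: "0 < T x0"
    and ne: "\<And>t. t \<in> {0..<T x0} \<Longrightarrow> x t \<noteq> xs"
    using T x0 unfolding settling_time_def by fastforce
  from T_pos show ?thesis
  proof (rule dense_le_bounded)
    fix b assume b: "0 < b" "b < T x0"
    show "b \<le> B"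
    proof (rule B)
      show "continuous_on {0..b} x"
        using solution_continuous_on[OF x] by (rule continuous_on_subset) auto
      show "x t \<noteq> xs" if "t \<in> {0..b}" for t
        using ne[of t] that b by auto
      show "(x has_vector_derivative G (x t)) (at t)" if "t \<in> {0<..<b}" for t
        using solution_derivative_at[OF x] that by simp
    qed (use b in simp)
  qed
qed

lemma settling_time_exists: "\<exists>T. settling_time G xs UNIV T"
proof -
  have "\<forall>x0. \<exists>T. x0 \<noteq> xs \<longrightarrow> T > 0 \<and> (\<exists>z. solution G x0 z) \<and>
      (\<forall>z. solution G x0 z \<longrightarrow> (\<forall>t\<in>{0..<T}. z t \<noteq> xs) \<and> (z \<longlongrightarrow> xs) (at T))"
    using settling_point by blast
  then obtain T where "\<And>x0. x0 \<noteq> xs \<Longrightarrow> T x0 > 0 \<and> (\<exists>z. solution G x0 z) \<and>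
      (\<forall>z. solution G x0 z \<longrightarrow> (\<forall>t\<in>{0..<T x0}. z t \<noteq> xs) \<and> (z \<longlongrightarrow> xs) (at (T x0)))"
    by metis
  then have "settling_time G xs UNIV T"
    unfolding settling_time_def by simp
  then show ?thesis by blast
qed

text \<open>The distance to \<open>xs\<close> never increases along solutions, so the radius
  \<epsilon> itself serves as \<open>r\<close>.\<close>

lemma stable: "lyapunov_stable G xs"
  unfolding lyapunov_stable_def
proof (intro allI impI)
  fix \<epsilon> :: real assume \<epsilon>: "\<epsilon> > 0"
  have "\<exists>x. solution G x0 x" for x0
  proof (cases "x0 = xs")
    case True
    have "solution G xs (\<lambda>_. xs)"
      by (simp add: solution_def)
    with True show ?thesis by blast
  qed (use settling_point in blast)
  moreover have "x t \<in> ball xs \<epsilon>"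
    if "x0 \<in> ball xs \<epsilon>" "solution G x0 x" "t > 0" for x0 x and t :: real
    using solution_distance_nonincreasing[OF that(2), of 0 t] that
    by (simp add: solution_def dist_norm norm_minus_commute)
  ultimately show "\<exists>r>0. \<forall>x0\<in>ball xs r. (\<exists>x. solution G x0 x) \<and>
      (\<forall>x. solution G x0 x \<longrightarrow> (\<forall>t>0. x t \<in> ball xs \<epsilon>))"
    using \<epsilon> by blast
qed

lemma settling_time_le:
  assumes "settling_time G xs UNIV T" "x0 \<noteq> xs"
  shows "T x0 \<le> 1 / (p\<^sub>1 * (1 - (1 + \<kappa>\<^sub>1) / 2)) + 1 / (p\<^sub>2 * ((1 + \<kappa>\<^sub>2) / 2 - 1))"
proof (rule settling_time_bound[OF assms])
  fix b x assume "0 \<le> b" "continuous_on {0..b} x" "\<And>t. t \<in> {0..b} \<Longrightarrow> x t \<noteq> xs"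
    "\<And>t. t \<in> {0<..<b} \<Longrightarrow> (x has_vector_derivative G (x t)) (at t)"
  then show "b \<le> 1 / (p\<^sub>1 * (1 - (1 + \<kappa>\<^sub>1) / 2)) + 1 / (p\<^sub>2 * ((1 + \<kappa>\<^sub>2) / 2 - 1))"
    by (rule nonequilibrium_time_bound)
qed

lemma settling_time_le_pi:
  assumes "settling_time G xs UNIV T" "x0 \<noteq> xs"
    and "\<xi> > 0" "(1 + \<kappa>\<^sub>1) / 2 = 1 - 1 / (2 * \<xi>)" "(1 + \<kappa>\<^sub>2) / 2 = 1 + 1 / (2 * \<xi>)"
  shows "T x0 \<le> pi * \<xi> / sqrt (p\<^sub>1 * p\<^sub>2)"
proof (rule settling_time_bound[OF assms(1,2)])
  fix b x assume "0 \<le> b" "continuous_on {0..b} x" "\<And>t. t \<in> {0..b} \<Longrightarrow> x t \<noteq> xs"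
    "\<And>t. t \<in> {0<..<b} \<Longrightarrow> (x has_vector_derivative G (x t)) (at t)"
  then show "b \<le> pi * \<xi> / sqrt (p\<^sub>1 * p\<^sub>2)"
    using assms(3-5) by (rule nonequilibrium_time_bound_pi)
qed

lemma fixed_time_stable: "fixed_time_stable G xs"
proof -
  have "bdd_above (T ` (UNIV - {xs}))" if "settling_time G xs UNIV T" for T
    by (rule bdd_aboveI2, rule settling_time_le[OF that]) simp
  then show ?thesis
    unfolding fixed_time_stable_def globally_finite_time_stable_def finite_time_stable_on_def
    using stable settling_time_exists by simp
qed

end

section \<open>Fixed-time stability of the forward-backward dynamics\<close>

theorem proposition5p1:
  fixes f g :: "'a::euclidean_space \<Rightarrow> real"
    and gradf U G :: "'a \<Rightarrow> 'a"
    and \<mu> L l c\<^sub>1 c\<^sub>2 \<kappa>\<^sub>1 \<kappa>\<^sub>2 :: real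
    and xs :: 'a
  assumes f_grad: "\<And>x. GDERIV f x :> gradf x"
    and f_C1: "continuous_on UNIV gradf"
    and f_convex: "convex_on UNIV f"
    and g_proper: "proper (\<lambda>x. ereal (g x))"
    and g_lsc: "lower_semicontinuous (\<lambda>x. ereal (g x))"
    and g_convex: "convex_on UNIV g"
    and "\<mu> > 0" and "L > 0" and "l > 0"
    and f_strong: "strongly_convex_on UNIV \<mu> f"
    and f_Lip: "L-lipschitz_on UNIV gradf"
    and "l * L\<^sup>2 < 2 * \<mu>"
    and "c\<^sub>1 > 0" and "c\<^sub>2 > 0" and "0 < \<kappa>\<^sub>1" and "\<kappa>\<^sub>1 < 1" and "\<kappa>\<^sub>2 > 1"
    and xs_min: "is_arg_min (\<lambda>x. f x + g x) (\<lambda>_. True) xs"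
  defines "U \<equiv> prox l g \<circ> (\<lambda>x. x - l *\<^sub>R gradf x)"
    and "G \<equiv> (\<lambda>x. - (scaling c\<^sub>1 c\<^sub>2 \<kappa>\<^sub>1 \<kappa>\<^sub>2 U x *\<^sub>R (x - prox l g (x - l *\<^sub>R gradf x))))"
  shows "equilibrium_point G xs \<and> fixed_time_stable G xs \<and>
    (\<exists>p\<^sub>1 p\<^sub>2 \<alpha>\<^sub>1 \<alpha>\<^sub>2 :: real.
       p\<^sub>1 > 0 \<and> p\<^sub>2 > 0 \<and> 1 / 2 < \<alpha>\<^sub>1 \<and> \<alpha>\<^sub>1 < 1 \<and> \<alpha>\<^sub>2 > 1 \<and>
       \<alpha>\<^sub>1 = (1 + \<kappa>\<^sub>1) / 2 \<and> \<alpha>\<^sub>2 = (1 + \<kappa>\<^sub>2) / 2 \<and>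
       (\<forall>T. settling_time G xs UNIV T \<longrightarrow>
          (\<forall>x0. x0 \<noteq> xs \<longrightarrow>
             T x0 \<le> 1 / (p\<^sub>1 * (1 - \<alpha>\<^sub>1)) + 1 / (p\<^sub>2 * (\<alpha>\<^sub>2 - 1))) \<and>
          (\<forall>\<xi>>1. \<alpha>\<^sub>1 = 1 - 1 / (2 * \<xi>) \<and> \<alpha>\<^sub>2 = 1 + 1 / (2 * \<xi>) \<longrightarrow>
             (\<forall>x0. x0 \<noteq> xs \<longrightarrow> T x0 \<le> pi * \<xi> / sqrt (p\<^sub>1 * p\<^sub>2)))))"
proof -
  obtain q where q: "0 \<le> q" "q < 1"
    and "\<And>x y. norm (prox l g (x - l *\<^sub>R gradf x) - prox l g (y - l *\<^sub>R gradf y)) \<le> q * norm (x - y)"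
    using forward_backward_contraction[OF f_grad f_strong f_Lip g_convex \<open>l > 0\<close> \<open>l * L\<^sup>2 < 2 * \<mu>\<close>]
    by blast
  then have contraction: "norm (U x - U y) \<le> q * norm (x - y)" for x y
    by (simp add: U_def)
  have fixpoint: "U xs = xs"
    using forward_backward_fixed_point[OF f_grad g_convex \<open>l > 0\<close> xs_min] by (simp add: U_def)
  interpret dyn: contraction_dynamics U xs q c\<^sub>1 c\<^sub>2 \<kappa>\<^sub>1 \<kappa>\<^sub>2
    by unfold_locales fact+
  have G: "G = dyn.G"
    unfolding fun_eq_iff dyn.G_def dyn.R_def dyn.\<phi>_def by (simp add: G_def U_def)
  have bounds: "T x0 \<le> 1 / (dyn.p\<^sub>1 * (1 - (1 + \<kappa>\<^sub>1) / 2)) + 1 / (dyn.p\<^sub>2 * ((1 + \<kappa>\<^sub>2) / 2 - 1))"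
    "\<lbrakk>\<xi> > 1; (1 + \<kappa>\<^sub>1) / 2 = 1 - 1 / (2 * \<xi>); (1 + \<kappa>\<^sub>2) / 2 = 1 + 1 / (2 * \<xi>)\<rbrakk>
      \<Longrightarrow> T x0 \<le> pi * \<xi> / sqrt (dyn.p\<^sub>1 * dyn.p\<^sub>2)"
    if "settling_time dyn.G xs UNIV T" "x0 \<noteq> xs" for T x0 \<xi>
    using dyn.settling_time_le[OF that] dyn.settling_time_le_pi[OF that, of \<xi>] by simp_all
  have "1 / 2 < (1 + \<kappa>\<^sub>1) / 2" "(1 + \<kappa>\<^sub>1) / 2 < 1" "(1 + \<kappa>\<^sub>2) / 2 > 1"
    using \<open>0 < \<kappa>\<^sub>1\<close> \<open>\<kappa>\<^sub>1 < 1\<close> \<open>\<kappa>\<^sub>2 > 1\<close> by simp_all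
  moreover have "equilibrium_point dyn.G xs"
    by (simp add: equilibrium_point_def)
  ultimately show ?thesis
    unfolding G using dyn.p_pos dyn.fixed_time_stable bounds by blast
qed

end
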